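(* Let $n\ge 9$ be odd, and set $k=\lfloor n/2\rfloor$. For $Y=(y_{i,j})\in\mathbb R^{C}$, $i\in[k]$ and $j\in[k-1]$ write $$L_{i,j}(Y)=\sum_{i'=1}^{\min\{i,j\}}y_{i',i}+\sum_{j'=i+1}^{j}y_{i,j'}.$$ The facets of $P^{\mathrm{core}}_{\mathrm{TSASM}}$ are exactly the following faces of $P^{\mathrm{core}}_{\mathrm{TSASM}}$, one for each listed equation: (a) $\{L_{i,j}(Y)=0\}$ for $(i,j)\in\{(2,2)\}\cup\{(i,j): i\in[3,k-1],\ j\in[2,k-1-\chi_{2\mid i}]\}\cup\bigl(\{k\}\times\{j\in[3,k-1-\chi_{2\nmid k}]: 2\nmid j\}\bigr)$; (b) $\{L_{i,j}(Y)=1\}$ for $(i,j)\in\{(i,j): i\in[4,k-1],\ j\in[4,k-1-\chi_{2\nmid i}]\}\cup\bigl(\{k\}\times\{j\in[4,k-1-\chi_{2\mid k}]: 2\mid j\}\bigr)$. In particular, the number of facets of $P^{\mathrm{core}}_{\mathrm{TSASM}}$ is $\frac{n^2-15n+62}{2}$.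
   Context: $[a,b]=\{a,a+1,\dots,b\}$ for integers $a\le b$, $[a,b]=\emptyset$ if $a>b$, and $[n]=[1,n]$; empty sums are $0$. $\chi_{\mathcal P}$ equals $1$ if the predicate $\mathcal P$ holds and $0$ otherwise. An $n\times n$ alternating sign matrix (ASM) is an $n\times n$ matrix with entries in $\{0,1,-1\}$ such that in each row and each column the non-zero entries alternate in sign and the first and last non-zero entries are $1$ (so every row and column sums to $1$). A TSASM is an $n\times n$ ASM $X$ invariant under all symmetries of the square, equivalently $x_{i,j}=x_{i,n+1-j}=x_{j,i}$ for all $i,j\in[n]$. For odd $n$ and $k=\lfloor n/2\rfloor$, the set of core positions is $C=\{(i,j)\in[k]\times[k]: i\le j\}$. The core of a TSASM $X$ is $(x_{i,j})_{(i,j)\in C}\in\mathbb R^C$, and $P^{\mathrm{core}}_{\mathrm{TSASM}}\subseteq\mathbb R^{C}$ is the convex hull of the cores of all $n\times n$ TSASMs. A facet of a polytope $P$ is a face of dimension $\dim P-1$; by "the face $\{L(Y)=c\}$" we mean $\{Y\in P^{\mathrm{core}}_{\mathrm{TSASM}}: L(Y)=c\}$. *)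

theory Defs
  imports "HOL-Analysis.Analysis"
begin

text \<open>
  Matrices are functions of type \<open>nat \<Rightarrow> nat \<Rightarrow> real\<close> with 1-based indices; an \<open>n \<times> n\<close> matrix is
  only ever inspected at indices in \<open>{1..n}\<close>.
\<close>

definition nonzero_entries :: "nat \<Rightarrow> (nat \<Rightarrow> real) \<Rightarrow> real list" where
  "nonzero_entries n f = filter (\<lambda>x. x \<noteq> 0) (map f [1..<n + 1])"

definition alternating_line :: "nat \<Rightarrow> (nat \<Rightarrow> real) \<Rightarrow> bool" where
  "alternating_line n f \<longleftrightarrow>
     nonzero_entries n f \<noteq> [] \<and>
     hd (nonzero_entries n f) = 1 \<and>
     last (nonzero_entries n f) = 1 \<and>
     successively (\<lambda>x y. sgn y = - sgn x) (nonzero_entries n f)"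

definition asm :: "nat \<Rightarrow> (nat \<Rightarrow> nat \<Rightarrow> real) \<Rightarrow> bool" where
  "asm n X \<longleftrightarrow>
     (\<forall>i\<in>{1..n}. \<forall>j\<in>{1..n}. X i j \<in> {0, 1, -1}) \<and>
     (\<forall>i\<in>{1..n}. alternating_line n (\<lambda>j. X i j)) \<and>
     (\<forall>j\<in>{1..n}. alternating_line n (\<lambda>i. X i j))"

definition tsasm :: "nat \<Rightarrow> (nat \<Rightarrow> nat \<Rightarrow> real) \<Rightarrow> bool" where
  "tsasm n X \<longleftrightarrow>
     asm n X \<and>
     (\<forall>i\<in>{1..n}. \<forall>j\<in>{1..n}. X i j = X i (n + 1 - j) \<and> X i j = X j i)"

definition core_positions :: "nat \<Rightarrow> (nat \<times> nat) set" where
  "core_positions n = {(i, j) \<in> {1..n div 2} \<times> {1..n div 2}. i \<le> j}"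

text \<open>
  The space \<open>\<real>\<^sup>C\<close> for \<open>C = core_positions n\<close> is represented as \<open>real ^ 'c\<close>, where the finite index
  type \<open>'c\<close> is identified with \<open>C\<close> by a bijection \<open>pos\<close> from \<open>UNIV :: 'c set\<close> onto \<open>C\<close>.
\<close>

definition core :: "('c::finite \<Rightarrow> nat \<times> nat) \<Rightarrow> (nat \<Rightarrow> nat \<Rightarrow> real) \<Rightarrow> real ^ 'c" where
  "core pos X = (\<chi> c. X (fst (pos c)) (snd (pos c)))"

definition entry :: "('c::finite \<Rightarrow> nat \<times> nat) \<Rightarrow> real ^ 'c \<Rightarrow> nat \<Rightarrow> nat \<Rightarrow> real" where
  "entry pos Y i j = Y $ inv pos (i, j)"

definition tsasm_core_polytope :: "nat \<Rightarrow> ('c::finite \<Rightarrow> nat \<times> nat) \<Rightarrow> (real ^ 'c) set" where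
  "tsasm_core_polytope n pos = convex hull (core pos ` {X. tsasm n X})"

definition L :: "('c::finite \<Rightarrow> nat \<times> nat) \<Rightarrow> nat \<Rightarrow> nat \<Rightarrow> real ^ 'c \<Rightarrow> real" where
  "L pos i j Y = (\<Sum>i'=1..min i j. entry pos Y i' i) + (\<Sum>j'=i + 1..j. entry pos Y i j')"

text \<open>
  The index sets of the equations \<open>L\<^sub>i\<^sub>,\<^sub>j = 0\<close> and \<open>L\<^sub>i\<^sub>,\<^sub>j = 1\<close>, for \<open>k = n div 2\<close>. They are used only
  for \<open>k \<ge> 4\<close>, where no subtraction truncates.
\<close>

definition zero_indices :: "nat \<Rightarrow> (nat \<times> nat) set" where
  "zero_indices k =
     {(2, 2)} \<union>
     {(i, j). i \<in> {3..k - 1} \<and> j \<in> {2..k - 1 - of_bool (even i)}} \<union>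
     {k} \<times> {j \<in> {3..k - 1 - of_bool (odd k)}. odd j}"

definition one_indices :: "nat \<Rightarrow> (nat \<times> nat) set" where
  "one_indices k =
     {(i, j). i \<in> {4..k - 1} \<and> j \<in> {4..k - 1 - of_bool (odd i)}} \<union>
     {k} \<times> {j \<in> {4..k - 1 - of_bool (even k)}. even j}"

end

theory Submission
  imports Defs
begin

text \<open>
  By the symmetries, \<open>L\<^sub>i\<^sub>,\<^sub>j\<close> is a partial row sum of the symmetric upper left \<open>k \<times> k\<close> block, so in terms
  of the corner sums \<open>h i j\<close> (which are symmetric, vanish on the first row and equal \<open>i div 2\<close> at
  \<open>j = k\<close>) it is the difference \<open>h i j - h (i - 1) j\<close>. Hence the cores are the integer points of a
  system of difference constraints with integer bounds, whose extreme points are integral, and the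
  polytope is the solution set of \<open>0 \<le> L\<^sub>i\<^sub>,\<^sub>j \<le> 1\<close>. The constraints not listed follow from the listed
  ones by comparison with the boundary values. No listed constraint is redundant: the greatest
  admissible array with the least possible value at \<open>(i, j)\<close>, raised by one at \<open>(i - 1, j)\<close>, violates
  only \<open>L\<^sub>i\<^sub>,\<^sub>j \<ge> 0\<close>; dually, the least admissible array with the greatest possible value at \<open>(i, j)\<close>,
  lowered by one at \<open>(i - 1, j)\<close>, violates only \<open>L\<^sub>i\<^sub>,\<^sub>j \<le> 1\<close>.
  For \<open>L\<^sub>2\<^sub>,\<^sub>2 \<ge> 0\<close>, where \<open>(1, 2)\<close> is fixed, the least array is lowered at \<open>(2, 2)\<close> instead.
\<close>

section \<open>Facets of irredundant systems\<close>

lemma facets_of_irredundant_system: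
  fixes f :: "'t \<Rightarrow> 'a::euclidean_space \<Rightarrow> real"
  assumes "finite T" and "affine A" and lin: "\<And>t. t \<in> T \<Longrightarrow> linear (f t)"
    and S: "S = {x \<in> A. \<forall>t\<in>T. f t x \<le> b t}"
    and z: "z \<in> A" "\<And>t. t \<in> T \<Longrightarrow> f t z < b t"
    and w: "\<And>t. t \<in> T \<Longrightarrow> w t \<in> A" "\<And>t. t \<in> T \<Longrightarrow> b t < f t (w t)"
      "\<And>s t. s \<in> T \<Longrightarrow> t \<in> T \<Longrightarrow> s \<noteq> t \<Longrightarrow> f s (w t) \<le> b s"
  shows "bij_betw (\<lambda>t. {x \<in> S. f t x = b t}) T {F. F facet_of S}"
proof -
  define hs where "hs t = {x. f t x \<le> b t}" for t
  define g where "g t = adjoint (f t) 1" for t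
  have g: "g t \<bullet> x = f t x" if "t \<in> T" for t x
    using adjoint_works[OF lin[OF that], of x 1] by (simp add: g_def inner_commute)
  \<comment> \<open>The parameter at which \<open>f t\<close> reaches \<open>b t\<close> on the
    segment from \<open>z\<close> to \<open>w t\<close>; \<open>p t\<close> is the crossing
    point.\<close>
  define l where "l t = (b t - f t z) / (f t (w t) - f t z)" for t
  define p where "p t = (1 - l t) *\<^sub>R z + l t *\<^sub>R w t" for t
  have l: "0 < l t" "l t < 1" if "t \<in> T" for t
    using z(2)[OF that] w(2)[OF that] by (auto simp: l_def)
  have fp: "f s (p t) = (1 - l t) * f s z + l t * f s (w t)" if "s \<in> T" for s t
    using lin[OF that] by (simp add: p_def linear_add linear_scale)
  have p_eq: "f t (p t) = b t" if "t \<in> T" for t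
  proof -
    have "f t (p t) = f t z + l t * (f t (w t) - f t z)"
      using fp[OF that] by (simp add: algebra_simps)
    also have "\<dots> = b t"
      using z(2)[OF that] w(2)[OF that] by (simp add: l_def)
    finally show ?thesis .
  qed
  have p_less: "f s (p t) < b s" if "s \<in> T" "t \<in> T" "s \<noteq> t" for s t
  proof -
    have "(1 - l t) * f s z < (1 - l t) * b s"
      using l[OF that(2)] z(2)[OF that(1)] by simp
    moreover have "l t * f s (w t) \<le> l t * b s"
      using l[OF that(2)] w(3)[OF that] by simp
    ultimately show ?thesis
      using fp[OF that(1), of t] by (simp add: algebra_simps)
  qed
  have pA: "p t \<in> A" if "t \<in> T" for t
    unfolding p_def using \<open>affine A\<close> z(1) w(1)[OF that]
    by (simp add: mem_affine)
  have pS: "p t \<in> S" if "t \<in> T" for t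
  proof -
    have "f s (p t) \<le> b s" if "s \<in> T" for s
      using p_eq[OF \<open>t \<in> T\<close>] p_less[OF that \<open>t \<in> T\<close>] by (cases "s = t") auto
    then show ?thesis unfolding S using pA[OF that] by simp
  qed
  have zS: "z \<in> S"
    unfolding S using z by (auto intro: less_imp_le)
  \<comment> \<open>The facet criterion works in \<open>affine hull S\<close>, which could be
    smaller than \<open>A\<close>. The point \<open>w t\<close> is in it, being on the line through
    \<open>z\<close> and \<open>p t\<close>, both in \<open>S\<close>.\<close>
  have wS: "w t \<in> affine hull S" if "t \<in> T" for t
  proof -
    have "(1 - 1 / l t) *\<^sub>R z + (1 / l t) *\<^sub>R p t \<in> affine hull S"
      using zS pS[OF that] by (intro mem_affine) (auto simp: hull_inc)
    moreover have "(1 - 1 / l t) *\<^sub>R z + (1 / l t) *\<^sub>R p t = w t"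
      using l[OF that] by (simp add: p_def scaleR_add_right algebra_simps)
    ultimately show ?thesis by simp
  qed
  have inj: "inj_on hs T"
  proof (rule inj_onI)
    fix s t assume "s \<in> T" "t \<in> T" "hs s = hs t"
    then show "s = t"
      using w(2)[of t] w(3)[of s t] unfolding hs_def by (metis linorder_not_le mem_Collect_eq)
  qed
  have SA: "affine hull S \<subseteq> A"
    using \<open>affine A\<close> S by (intro hull_minimal) auto
  have seq: "S = affine hull S \<inter> \<Inter>(hs ` T)"
    using SA hull_subset[of S affine] by (auto simp: S hs_def)
  \<comment> \<open>The criterion is indexed by the half-spaces themselves; \<open>h\<close>
    recovers the index from the half-space.\<close>
  define h where "h = inv_into T hs"
  have h: "h (hs t) = t" if "t \<in> T" for t
    using inj that by (simp add: h_def)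
  have facet: "C facet_of S \<longleftrightarrow> (\<exists>H. H \<in> hs ` T \<and> C = S \<inter> {x. g (h H) \<bullet> x = b (h H)})" for C
  proof (rule facet_of_polyhedron_explicit[OF _ seq])
    show "finite (hs ` T)" using \<open>finite T\<close> by simp
  next
    fix H assume "H \<in> hs ` T"
    then obtain t where t: "t \<in> T" "H = hs t" by blast
    have "g t \<noteq> 0"
      using g[OF t(1), of z] g[OF t(1), of "w t"] z(2)[OF t(1)] w(2)[OF t(1)] by auto
    then show "g (h H) \<noteq> 0 \<and> H = {x. g (h H) \<bullet> x \<le> b (h H)}"
      using t h g by (simp add: hs_def)
  next
    \<comment> \<open>Irredundancy: if \<open>F'\<close> omits \<open>hs t\<close>, then
      \<open>w t\<close> satisfies everything in \<open>F'\<close> but lies outside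
      \<open>S\<close>.\<close>
    fix F' assume F': "F' \<subset> hs ` T"
    then obtain t where t: "t \<in> T" "hs t \<notin> F'" by blast
    have "w t \<in> H" if H: "H \<in> F'" for H
    proof -
      obtain s where s: "s \<in> T" "H = hs s" using F' H by blast
      with t H have "s \<noteq> t" by blast
      then show ?thesis using s t w(3) by (simp add: hs_def)
    qed
    moreover have "w t \<notin> S" using w(2)[OF t(1)] t(1) by (force simp: S)
    moreover have "S \<subseteq> affine hull S \<inter> \<Inter>F'" using seq F' by blast
    ultimately show "S \<subset> affine hull S \<inter> \<Inter>F'" using wS[OF t(1)] by blast
  qed
  have "{F. F facet_of S} = (\<lambda>t. {x \<in> S. f t x = b t}) ` T"
    unfolding facet using g h by (auto simp: image_iff Int_def)
  moreover have "inj_on (\<lambda>t. {x \<in> S. f t x = b t}) T"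
  proof (rule inj_onI)
    fix s t assume st: "s \<in> T" "t \<in> T" "{x \<in> S. f s x = b s} = {x \<in> S. f t x = b t}"
    \<comment> \<open>Among the hyperplanes of the system, \<open>p t\<close> lies on that of
      \<open>t\<close> only, so it tells the faces apart.\<close>
    have "p t \<in> {x \<in> S. f t x = b t}" using pS p_eq st by simp
    then have "f s (p t) = b s" using st(3) by blast
    then show "s = t" using p_less[of s t] st by fastforce
  qed
  ultimately show ?thesis by (simp add: bij_betw_def)
qed

section \<open>Integer arrays violating one constraint\<close>

text \<open>Stated on the whole integer plane, so that index edges need no care. Closure under
  minimum, maximum, swapping and adding constants allows the extremal arrays to be assembled from
  simple pieces.\<close>

definition gradual :: "(int \<Rightarrow> int \<Rightarrow> int) \<Rightarrow> bool" where
  "gradual h \<longleftrightarrow> (\<forall>p q. h (p - 1) q \<le> h p q \<and> h p q \<le> h (p - 1) q + 1 \<and>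
     h p (q - 1) \<le> h p q \<and> h p q \<le> h p (q - 1) + 1)"

lemma gradual_min:
  assumes "gradual f" "gradual g"
  shows "gradual (\<lambda>p q. min (f p q) (g p q))"
  unfolding gradual_def
proof (intro allI)
  fix p q
  show "min (f (p - 1) q) (g (p - 1) q) \<le> min (f p q) (g p q) \<and>
      min (f p q) (g p q) \<le> min (f (p - 1) q) (g (p - 1) q) + 1 \<and>
      min (f p (q - 1)) (g p (q - 1)) \<le> min (f p q) (g p q) \<and>
      min (f p q) (g p q) \<le> min (f p (q - 1)) (g p (q - 1)) + 1"
    using assms[unfolded gradual_def, rule_format, of p q] by (auto simp: min_def)
qed

lemma gradual_max:
  assumes "gradual f" "gradual g"
  shows "gradual (\<lambda>p q. max (f p q) (g p q))"
  unfolding gradual_def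
proof (intro allI)
  fix p q
  show "max (f (p - 1) q) (g (p - 1) q) \<le> max (f p q) (g p q) \<and>
      max (f p q) (g p q) \<le> max (f (p - 1) q) (g (p - 1) q) + 1 \<and>
      max (f p (q - 1)) (g p (q - 1)) \<le> max (f p q) (g p q) \<and>
      max (f p q) (g p q) \<le> max (f p (q - 1)) (g p (q - 1)) + 1"
    using assms[unfolded gradual_def, rule_format, of p q] by (auto simp: max_def)
qed

lemma gradual_swap: "gradual f \<Longrightarrow> gradual (\<lambda>p q. f q p)"
  by (simp add: gradual_def)

lemma gradual_const: "gradual (\<lambda>p q. c)"
  by (simp add: gradual_def)

lemma gradual_add_const: "gradual f \<Longrightarrow> gradual (\<lambda>p q. c + f p q)"
  by (simp add: gradual_def add.assoc)

lemma gradual_half: "gradual (\<lambda>p q. p div 2)"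
  unfolding gradual_def by linarith

lemma gradual_half_minus: "gradual (\<lambda>p q. p div 2 - (k - q))"
  unfolding gradual_def by linarith

text \<open>This is the greatest gradual array with value 0 at \<open>(i, j)\<close>: each forward
  step gains at most one and each backward step gains nothing.\<close>

lemma gradual_cone: "gradual (\<lambda>p q. max 0 (p - i) + max 0 (q - j))"
  unfolding gradual_def by (auto simp: max_def)

text \<open>Dually, the least gradual array with value 0 at \<open>(i, j)\<close>.\<close>

lemma gradual_neg_cone: "gradual (\<lambda>p q. - (max 0 (i - p) + max 0 (j - q)))"
  unfolding gradual_def by (auto simp: max_def)

text \<open>
  The greatest and the least array with the prescribed boundary values, and their variants subject to
  the least, respectively the greatest, possible value at \<open>(i, j)\<close>.
\<close>

definition upper_corner :: "int \<Rightarrow> int \<Rightarrow> int" where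
  "upper_corner p q = min (p div 2) (q div 2)"

definition lower_corner :: "int \<Rightarrow> int \<Rightarrow> int \<Rightarrow> int" where
  "lower_corner k p q = max 0 (max (p div 2 - (k - q)) (q div 2 - (k - p)))"

definition upper_corner_from :: "int \<Rightarrow> int \<Rightarrow> int \<Rightarrow> int \<Rightarrow> int \<Rightarrow> int" where
  "upper_corner_from k i j p q = min (upper_corner p q)
     (lower_corner k i j + min (max 0 (p - i) + max 0 (q - j)) (max 0 (q - i) + max 0 (p - j)))"

definition lower_corner_from :: "int \<Rightarrow> int \<Rightarrow> int \<Rightarrow> int \<Rightarrow> int \<Rightarrow> int" where
  "lower_corner_from k i j p q = max (lower_corner k p q)
     (upper_corner i j + max (- (max 0 (i - p) + max 0 (j - q))) (- (max 0 (i - q) + max 0 (j - p))))"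

lemma gradual_upper_corner: "gradual upper_corner"
  using gradual_min[OF gradual_half gradual_swap[OF gradual_half]]
  by (simp add: upper_corner_def[abs_def])

lemma gradual_lower_corner: "gradual (lower_corner k)"
  using gradual_max[OF gradual_const[of 0]
    gradual_max[OF gradual_half_minus[of k] gradual_swap[OF gradual_half_minus[of k]]]]
  by (simp add: lower_corner_def[abs_def])

lemma gradual_upper_corner_from: "gradual (upper_corner_from k i j)"
  using gradual_min[OF gradual_upper_corner gradual_add_const[OF
    gradual_min[OF gradual_cone[of i j] gradual_swap[OF gradual_cone[of i j]]], of "lower_corner k i j"]]
  by (simp add: upper_corner_from_def[abs_def])

lemma gradual_lower_corner_from: "gradual (lower_corner_from k i j)"
  using gradual_max[OF gradual_lower_corner[of k] gradual_add_const[OF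
    gradual_max[OF gradual_neg_cone[of i j] gradual_swap[OF gradual_neg_cone[of i j]]], of "upper_corner i j"]]
  by (simp add: lower_corner_from_def[abs_def])

lemma upper_corner_from_sym: "upper_corner_from k i j p q = upper_corner_from k i j q p"
  unfolding upper_corner_from_def upper_corner_def by (simp add: min.commute)

lemma lower_corner_sym: "lower_corner k p q = lower_corner k q p"
  unfolding lower_corner_def by (simp add: max.commute)

lemma lower_corner_from_sym: "lower_corner_from k i j p q = lower_corner_from k i j q p"
  unfolding lower_corner_from_def by (subst lower_corner_sym) (simp add: max.commute)

lemma add_max_le_iff: "(c::int) + max a b \<le> d \<longleftrightarrow> c + a \<le> d \<and> c + b \<le> d"
  by (auto simp: max_def)

lemma half_le: "(p::int) div 2 \<le> q div 2 + max 0 (p - q)"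
  by linarith

lemma lower_corner_boundary:
  assumes "1 \<le> q" "q \<le> k"
  shows "lower_corner k 1 q = 0" "lower_corner k q k = q div 2"
proof -
  have "1 div 2 = (0::int)" "q div 2 \<le> q - 1" "q div 2 - (k - 1) \<le> 0" using assms by linarith+
  then show "lower_corner k 1 q = 0"
    using assms unfolding lower_corner_def by simp
  have "k div 2 - (k - q) \<le> q div 2" "0 \<le> q div 2" using assms by linarith+
  then show "lower_corner k q k = q div 2"
    unfolding lower_corner_def by simp
qed

lemma upper_corner_boundary:
  assumes "1 \<le> q" "q \<le> k"
  shows "upper_corner 1 q = 0" "upper_corner q k = q div 2"
proof -
  have "0 \<le> q div 2" "q div 2 \<le> k div 2" using assms by linarith+
  then show "upper_corner 1 q = 0" "upper_corner q k = q div 2"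
    unfolding upper_corner_def by simp_all
qed

text \<open>Prescribing the least value at \<open>(i, j)\<close> does not disturb the boundary: the
  cone on it and the mirrored cone are non-negative and reach at least \<open>q div 2\<close> in
  column \<open>k\<close>, because halving grows no faster than the cone.\<close>

lemma upper_corner_from_boundary:
  assumes "1 \<le> i" "i \<le> k" "1 \<le> j" "j \<le> k" "1 \<le> q" "q \<le> k"
  shows "upper_corner_from k i j 1 q = 0" "upper_corner_from k i j q k = q div 2"
proof -
  have l: "0 \<le> lower_corner k i j" "i div 2 - (k - j) \<le> lower_corner k i j"
    "j div 2 - (k - i) \<le> lower_corner k i j"
    by (simp_all add: lower_corner_def)
  show "upper_corner_from k i j 1 q = 0"
    using l(1) upper_corner_boundary(1)[OF assms(5,6)] by (simp add: upper_corner_from_def)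
  have "q div 2 \<le> lower_corner k i j + (max 0 (q - i) + max 0 (k - j))"
    using l(2) half_le[of q i] assms by simp
  moreover have "q div 2 \<le> lower_corner k i j + (max 0 (k - i) + max 0 (q - j))"
    using l(3) half_le[of q j] assms by simp
  ultimately show "upper_corner_from k i j q k = q div 2"
    using upper_corner_boundary(2)[OF assms(5,6)] by (simp add: upper_corner_from_def min_add_distrib_right)
qed

lemma lower_corner_from_boundary:
  assumes "1 \<le> i" "i \<le> k" "1 \<le> j" "j \<le> k" "1 \<le> q" "q \<le> k"
  shows "lower_corner_from k i j 1 q = 0" "lower_corner_from k i j q k = q div 2"
proof -
  have u: "upper_corner i j \<le> i div 2" "upper_corner i j \<le> j div 2"
    by (simp_all add: upper_corner_def)
  have "i div 2 \<le> i - 1" "j div 2 \<le> j - 1" using assms by linarith+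
  then have "upper_corner i j - (max 0 (i - 1) + max 0 (j - q)) \<le> 0"
    "upper_corner i j - (max 0 (i - q) + max 0 (j - 1)) \<le> 0"
    using u assms by simp_all
  then show "lower_corner_from k i j 1 q = 0"
    using lower_corner_boundary(1)[OF assms(5,6)] by (simp add: lower_corner_from_def)
  have "upper_corner i j - (max 0 (i - q) + max 0 (j - k)) \<le> q div 2"
    "upper_corner i j - (max 0 (i - k) + max 0 (j - q)) \<le> q div 2"
    using u assms half_le[of i q] half_le[of j q] by simp_all
  then have "upper_corner i j + max (- (max 0 (i - q) + max 0 (j - k))) (- (max 0 (i - k) + max 0 (j - q))) \<le> q div 2"
    unfolding add_max_le_iff diff_conv_add_uminus by blast
  then show "lower_corner_from k i j q k = q div 2"
    unfolding lower_corner_from_def lower_corner_boundary(2)[OF assms(5,6)] by (rule max.absorb1)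
qed

section \<open>Comparison of the extremal arrays near a listed cell\<close>

lemma lower_corner_le_iff: "lower_corner k p q \<le> x \<longleftrightarrow> 0 \<le> x \<and> p div 2 - (k - q) \<le> x \<and> q div 2 - (k - p) \<le> x"
  unfolding lower_corner_def by auto

lemma le_upper_corner_iff: "x \<le> upper_corner p q \<longleftrightarrow> x \<le> p div 2 \<and> x \<le> q div 2"
  unfolding upper_corner_def by auto

lemma le_upper_corner_minus_iff: "x \<le> upper_corner p q - c \<longleftrightarrow> x \<le> p div 2 - c \<and> x \<le> q div 2 - c"
  unfolding upper_corner_def by auto

text \<open>Next to \<open>(i, j)\<close>, \<open>upper_corner\<close> does not cut into the cone
  with apex value \<open>lower_corner k i j\<close>. The parity conditions matter: for even
  \<open>i < k\<close> and \<open>j = k - 1\<close> the third bound fails, and for even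
  \<open>j\<close> in row \<open>k\<close> the second one does.\<close>

lemma lower_corner_bounds:
  assumes "4 \<le> k"
    and "3 \<le> i \<and> i \<le> k - 1 \<and> 2 \<le> j \<and> j \<le> k - 1 \<and> (even i \<longrightarrow> j \<le> k - 2) \<or>
      i = k \<and> odd j \<and> 3 \<le> j \<and> j \<le> k - 1"
  shows "lower_corner k i j \<le> upper_corner (i - 2) j"
    and "lower_corner k i j \<le> upper_corner (i - 1) (j - 1)"
    and "j \<noteq> i - 1 \<Longrightarrow> lower_corner k i j \<le> upper_corner (i - 1) (j + 1) - 1"
proof -
  \<comment> \<open>Splitting off the parities makes every division by two linear, so only linear
    arithmetic over finitely many parity cases remains.\<close>
  define a b r s where "a = i div 2" "b = j div 2" "r = i mod 2" "s = j mod 2"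
  then have ab: "i = 2 * a + r" "j = 2 * b + s" and rs: "r = 0 \<or> r = 1" "s = 0 \<or> s = 1"
    by auto
  have even: "even i \<longleftrightarrow> r = 0" "odd j \<longleftrightarrow> s = 1"
    using rs by (auto simp: ab)
  have half: "i div 2 = a" "j div 2 = b" "(i - 2) div 2 = a - 1" "(i - 1) div 2 = a - 1 + r"
    "(j - 1) div 2 = b - 1 + s" "(j + 1) div 2 = b + s"
    using rs by (auto simp: ab)
  note P = assms(2)[unfolded even]
  show "lower_corner k i j \<le> upper_corner (i - 2) j"
    unfolding lower_corner_le_iff le_upper_corner_iff le_upper_corner_minus_iff half using assms(1) P rs ab by (elim disjE) simp_all
  show "lower_corner k i j \<le> upper_corner (i - 1) (j - 1)"
    unfolding lower_corner_le_iff le_upper_corner_iff le_upper_corner_minus_iff half using assms(1) P rs ab by (elim disjE) simp_all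
  show "lower_corner k i j \<le> upper_corner (i - 1) (j + 1) - 1" if "j \<noteq> i - 1"
    unfolding lower_corner_le_iff le_upper_corner_iff le_upper_corner_minus_iff half using assms(1) P rs ab that by (elim disjE) simp_all
qed

text \<open>Dual of \<open>lower_corner_bounds\<close>: next to \<open>(i, j)\<close>,
  \<open>lower_corner\<close> stays below the inverted cone with apex value
  \<open>upper_corner i j\<close>. The third bound fails for odd \<open>i < k\<close> with
  \<open>j = k - 1\<close>, the second for odd \<open>j\<close> in row \<open>k\<close>.\<close>

lemma upper_corner_bounds:
  assumes "4 \<le> k"
    and "4 \<le> i \<and> i \<le> k - 1 \<and> 4 \<le> j \<and> j \<le> k - 1 \<and> (odd i \<longrightarrow> j \<le> k - 2) \<or>
      i = k \<and> even j \<and> 4 \<le> j \<and> j \<le> k - 1"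
  shows "lower_corner k (i - 2) j \<le> upper_corner i j - 2"
    and "lower_corner k (i - 1) (j - 1) \<le> upper_corner i j - 2"
    and "j \<noteq> i - 1 \<Longrightarrow> lower_corner k (i - 1) (j + 1) \<le> upper_corner i j - 1"
proof -
  define a b r s where "a = i div 2" "b = j div 2" "r = i mod 2" "s = j mod 2"
  then have ab: "i = 2 * a + r" "j = 2 * b + s" and rs: "r = 0 \<or> r = 1" "s = 0 \<or> s = 1"
    by auto
  have even: "odd i \<longleftrightarrow> r = 1" "even j \<longleftrightarrow> s = 0"
    using rs by (auto simp: ab)
  have half: "i div 2 = a" "j div 2 = b" "(i - 2) div 2 = a - 1" "(i - 1) div 2 = a - 1 + r"
    "(j - 1) div 2 = b - 1 + s" "(j + 1) div 2 = b + s"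
    using rs by (auto simp: ab)
  note P = assms(2)[unfolded even]
  show "lower_corner k (i - 2) j \<le> upper_corner i j - 2"
    unfolding lower_corner_le_iff le_upper_corner_iff le_upper_corner_minus_iff half using assms(1) P rs ab by (elim disjE) simp_all
  show "lower_corner k (i - 1) (j - 1) \<le> upper_corner i j - 2"
    unfolding lower_corner_le_iff le_upper_corner_iff le_upper_corner_minus_iff half using assms(1) P rs ab by (elim disjE) simp_all
  show "lower_corner k (i - 1) (j + 1) \<le> upper_corner i j - 1" if "j \<noteq> i - 1"
    unfolding lower_corner_le_iff le_upper_corner_iff le_upper_corner_minus_iff half using assms(1) P rs ab that by (elim disjE) simp_all
qed

section \<open>Arrays leaving the admissible range at a single cell\<close>

definition corner_array :: "int \<Rightarrow> (int \<Rightarrow> int \<Rightarrow> int) \<Rightarrow> bool" where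
  "corner_array k h \<longleftrightarrow> (\<forall>p q. h p q = h q p) \<and> (\<forall>q. 1 \<le> q \<and> q \<le> k \<longrightarrow> h 1 q = 0 \<and> h q k = q div 2)"

text \<open>It is applied with \<open>d = -1\<close> and \<open>d = 2\<close>, the integers just
  outside the admissible steps. Differences in the first index suffice because the array is
  symmetric.\<close>

definition violates_only :: "int \<Rightarrow> (int \<times> int) \<Rightarrow> int \<Rightarrow> (int \<Rightarrow> int \<Rightarrow> int) \<Rightarrow> bool" where
  "violates_only k e d w \<longleftrightarrow> corner_array k w \<and>
     (\<forall>p q. 2 \<le> p \<and> p \<le> k \<and> 1 \<le> q \<and> q \<le> k \<longrightarrow>
       (if (p, q) = e then w p q - w (p - 1) q = d else w p q - w (p - 1) q \<in> {0, 1}))"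

text \<open>Raising \<open>(i - 1, j)\<close> and its mirror cell changes only the differences that
  start or end there. By \<open>val\<close> each of them moves from 0 to 1 or from 1 to 0, except
  the one at \<open>(i, j)\<close>, which drops from 0 to -1.\<close>

lemma violates_only_raise:
  assumes v: "corner_array k v" "gradual v"
    and i: "3 \<le> i" "i \<le> k" and j: "2 \<le> j" "j < k"
    and val: "v (i - 1) j = v i j" "v (i - 2) j = v i j" "v (i - 1) (j - 1) = v i j"
      "j \<noteq> i - 1 \<Longrightarrow> v (i - 1) (j + 1) = v i j + 1"
  shows "violates_only k (i, j) (-1)
    (\<lambda>p q. v p q + (if p = i - 1 \<and> q = j \<or> q = i - 1 \<and> p = j then 1 else 0))"
proof -
  define w where "w p q = v p q + (if p = i - 1 \<and> q = j \<or> q = i - 1 \<and> p = j then 1 else 0)" for p q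
  have sym: "v p q = v q p" for p q using v(1) by (simp add: corner_array_def)
  have "corner_array k w"
    using v(1) i j by (auto simp: corner_array_def w_def)
  moreover have "w i j - w (i - 1) j = -1" using val(1) by (simp add: w_def)
  moreover have "w p q - w (p - 1) q \<in> {0, 1}" if ne: "(p, q) \<noteq> (i, j)" for p q
  proof -
    \<comment> \<open>If \<open>j = i - 1\<close>, the two raised cells coincide and the third case
      would be the excluded cell \<open>(i, j)\<close> itself.\<close>
    consider "p = i - 1" "q = j" | "p = j" "q = i - 1" | "p = j + 1" "q = i - 1" "j \<noteq> i - 1"
      | "\<not> (p = i - 1 \<and> q = j \<or> q = i - 1 \<and> p = j)" "\<not> (p - 1 = i - 1 \<and> q = j \<or> q = i - 1 \<and> p - 1 = j)"
      using ne by force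
    then show ?thesis
    proof cases
      case 1
      then show ?thesis using val by (simp add: w_def)
    next
      case 2
      then show ?thesis using val sym[of j "i - 1"] sym[of "j - 1" "i - 1"] by (simp add: w_def)
    next
      case 3
      then show ?thesis using val sym[of j "i - 1"] sym[of "j + 1" "i - 1"] by (simp add: w_def)
    next
      case 4
      then have "w p q - w (p - 1) q = v p q - v (p - 1) q" by (simp only: w_def if_False add_0_right diff_0_right)
      then show ?thesis using v(2)[unfolded gradual_def, rule_format, of p q] by simp linarith
    qed
  qed
  ultimately have "violates_only k (i, j) (-1) w" by (simp add: violates_only_def)
  then show ?thesis by (simp add: w_def[abs_def])
qed

text \<open>The same argument with signs reversed: the difference at \<open>(i, j)\<close> grows
  from 1 to 2 and the other affected ones stay in \<open>{0, 1}\<close>.\<close>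

lemma violates_only_lower:
  assumes v: "corner_array k v" "gradual v"
    and i: "3 \<le> i" "i \<le> k" and j: "2 \<le> j" "j < k"
    and val: "v (i - 1) j = v i j - 1" "v (i - 2) j = v i j - 2" "v (i - 1) (j - 1) = v i j - 2"
      "j \<noteq> i - 1 \<Longrightarrow> v (i - 1) (j + 1) = v i j - 1"
  shows "violates_only k (i, j) 2
    (\<lambda>p q. v p q - (if p = i - 1 \<and> q = j \<or> q = i - 1 \<and> p = j then 1 else 0))"
proof -
  define w where "w p q = v p q - (if p = i - 1 \<and> q = j \<or> q = i - 1 \<and> p = j then 1 else 0)" for p q
  have sym: "v p q = v q p" for p q using v(1) by (simp add: corner_array_def)
  have "corner_array k w"
    using v(1) i j by (auto simp: corner_array_def w_def)
  moreover have "w i j - w (i - 1) j = 2" using val(1) by (simp add: w_def)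
  moreover have "w p q - w (p - 1) q \<in> {0, 1}" if ne: "(p, q) \<noteq> (i, j)" for p q
  proof -
    consider "p = i - 1" "q = j" | "p = j" "q = i - 1" | "p = j + 1" "q = i - 1" "j \<noteq> i - 1"
      | "\<not> (p = i - 1 \<and> q = j \<or> q = i - 1 \<and> p = j)" "\<not> (p - 1 = i - 1 \<and> q = j \<or> q = i - 1 \<and> p - 1 = j)"
      using ne by force
    then show ?thesis
    proof cases
      case 1
      then show ?thesis using val by (simp add: w_def)
    next
      case 2
      then show ?thesis using val sym[of j "i - 1"] sym[of "j - 1" "i - 1"] by (simp add: w_def)
    next
      case 3
      then show ?thesis using val sym[of j "i - 1"] sym[of "j + 1" "i - 1"] by (simp add: w_def)
    next
      case 4
      then have "w p q - w (p - 1) q = v p q - v (p - 1) q" by (simp only: w_def if_False add_0_right diff_0_right)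
      then show ?thesis using v(2)[unfolded gradual_def, rule_format, of p q] by simp linarith
    qed
  qed
  ultimately have "violates_only k (i, j) 2 w" by (simp add: violates_only_def)
  then show ?thesis by (simp add: w_def[abs_def])
qed

lemma violates_only_zero:
  assumes k: "4 \<le> k"
    and P: "3 \<le> i \<and> i \<le> k - 1 \<and> 2 \<le> j \<and> j \<le> k - 1 \<and> (even i \<longrightarrow> j \<le> k - 2) \<or>
      i = k \<and> odd j \<and> 3 \<le> j \<and> j \<le> k - 1"
  shows "\<exists>w. violates_only k (i, j) (-1) w"
proof -
  let ?v = "upper_corner_from k i j" and ?m = "lower_corner k i j"
  note b = lower_corner_bounds[OF k P]
  have ij: "3 \<le> i" "i \<le> k" "2 \<le> j" "j < k" using P k by auto
  have mono: "upper_corner (i - 2) j \<le> upper_corner i j" "upper_corner (i - 2) j \<le> upper_corner (i - 1) j"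
    unfolding upper_corner_def by (intro min.mono zdiv_mono1; simp)+
  have "corner_array k ?v"
    unfolding corner_array_def using upper_corner_from_sym upper_corner_from_boundary[of i k j] ij by simp
  \<comment> \<open>At these cells the cone is 0, and the bounds keep \<open>upper_corner\<close>
    from cutting below the apex value.\<close>
  moreover have "?v i j = ?m" "?v (i - 1) j = ?m" "?v (i - 2) j = ?m" "?v (i - 1) (j - 1) = ?m"
    using b(1,2) mono unfolding upper_corner_from_def by (simp_all add: min_def max_def)
  \<comment> \<open>Here the cone is 1, while the mirrored cone is the absolute value of
    \<open>j + 1 - i\<close>, which is at least 1 unless \<open>j = i - 1\<close>.\<close>
  moreover have "?v (i - 1) (j + 1) = ?m + 1" if "j \<noteq> i - 1"
    using b(3)[OF that] that unfolding upper_corner_from_def by (auto simp: min_def max_def)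
  ultimately show ?thesis
    using violates_only_raise[of k ?v i j] gradual_upper_corner_from ij by auto
qed

lemma violates_only_one:
  assumes k: "4 \<le> k"
    and P: "4 \<le> i \<and> i \<le> k - 1 \<and> 4 \<le> j \<and> j \<le> k - 1 \<and> (odd i \<longrightarrow> j \<le> k - 2) \<or>
      i = k \<and> even j \<and> 4 \<le> j \<and> j \<le> k - 1"
  shows "\<exists>w. violates_only k (i, j) 2 w"
proof -
  let ?v = "lower_corner_from k i j" and ?m = "upper_corner i j"
  note b = upper_corner_bounds[OF k P]
  have ij: "4 \<le> i" "i \<le> k" "4 \<le> j" "j < k" using P k by auto
  note g = gradual_lower_corner[of k, unfolded gradual_def, rule_format]
  have mono: "lower_corner k (i - 1) j \<le> lower_corner k (i - 2) j + 1"
    "lower_corner k i j \<le> lower_corner k (i - 2) j + 2"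
    using g[of "i - 1" j] g[of i j] by auto
  have "corner_array k ?v"
    unfolding corner_array_def using lower_corner_from_sym lower_corner_from_boundary[of i k j] ij by simp
  moreover have "?v i j = ?m" "?v (i - 1) j = ?m - 1"
    using b(1) mono unfolding lower_corner_from_def by (auto simp: min_def max_def)
  moreover have "?v (i - 2) j = ?m - 2"
    using b(1) unfolding lower_corner_from_def by (auto simp: min_def max_def)
  moreover have "?v (i - 1) (j - 1) = ?m - 2"
    using b(2) unfolding lower_corner_from_def by (auto simp: min_def max_def)
  \<comment> \<open>As in the dual case, the mirrored cone interferes at this cell only when
    \<open>j = i - 1\<close>.\<close>
  moreover have "?v (i - 1) (j + 1) = ?m - 1" if "j \<noteq> i - 1"
    using b(3)[OF that] that unfolding lower_corner_from_def by (auto simp: min_def max_def)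
  ultimately show ?thesis
    using violates_only_lower[of k ?v i j] gradual_lower_corner_from ij by auto
qed

lemma violates_only_22:
  assumes k: "4 \<le> k"
  shows "\<exists>w. violates_only k (2, 2) (-1) w"
proof -
  let ?v = "lower_corner k"
  define w where "w p q = ?v p q - (if p = 2 \<and> q = 2 then 1 else 0)" for p q
  have "corner_array k ?v"
    unfolding corner_array_def using lower_corner_sym lower_corner_boundary by auto
  then have "corner_array k w"
    using k by (auto simp: corner_array_def w_def)
  \<comment> \<open>Besides its own difference, lowering \<open>(2, 2)\<close> changes only the one
    at \<open>(3, 2)\<close>, which becomes 1 since \<open>?v 3 2 = ?v 2 2\<close>.\<close>
  moreover have val: "?v 1 2 = 0" "?v 2 2 = 0" "?v 3 2 = 0"
    unfolding lower_corner_def using k by auto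
  moreover have "w p q - w (p - 1) q \<in> {0, 1}" if ne: "(p, q) \<noteq> (2, 2)" for p q
  proof (cases "p = 3 \<and> q = 2")
    case True
    then show ?thesis using val by (simp add: w_def)
  next
    case False
    then have "w p q - w (p - 1) q = ?v p q - ?v (p - 1) q" using ne by (auto simp: w_def)
    then show ?thesis using gradual_lower_corner[of k, unfolded gradual_def, rule_format, of p q] by simp linarith
  qed
  ultimately have "violates_only k (2, 2) (-1) w" by (simp add: violates_only_def w_def)
  then show ?thesis by blast
qed

section \<open>Listed and unlisted constraints\<close>

text \<open>Order of deduction: the listed steps into row \<open>k\<close>, whose values are known,
  confine row \<open>k - 1\<close> to the range from \<open>j div 2 - 1\<close> to
  \<open>j div 2\<close>. This gives monotonicity everywhere, hence
  \<open>0 \<le> h i j \<le> i div 2\<close> away from the last row and column, and these bounds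
  supply the missing upper bounds on the steps.\<close>

lemma all_bounds_of_listed_bounds:
  fixes h :: "nat \<Rightarrow> nat \<Rightarrow> real"
  assumes k: "4 \<le> k" and sym: "\<And>i j. h i j = h j i"
    and first: "\<And>j. 1 \<le> j \<Longrightarrow> j \<le> k \<Longrightarrow> h 1 j = 0"
    and last: "\<And>i. 1 \<le> i \<Longrightarrow> i \<le> k \<Longrightarrow> h i k = real (i div 2)"
    and zero: "\<And>i j. (i, j) \<in> zero_indices k \<Longrightarrow> h (i - 1) j \<le> h i j"
    and one: "\<And>i j. (i, j) \<in> one_indices k \<Longrightarrow> h i j \<le> h (i - 1) j + 1"
    and i: "2 \<le> i" "i \<le> k" and j: "1 \<le> j" "j \<le> k"
  shows "h (i - 1) j \<le> h i j \<and> h i j \<le> h (i - 1) j + 1"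
proof -
  have pred_half: "real ((i - 1) div 2) = real (i div 2) - 1" if "even i" "2 \<le> i" for i :: nat
  proof -
    have "(i - 1) div 2 + 1 = i div 2" using that by presburger
    then show ?thesis by linarith
  qed
  have "2 < k - 1" using k by simp
  have z22: "0 \<le> h 2 2" using zero[of 2 2] first[of 2] k by (simp add: zero_indices_def)
  have z: "h (i - 1) j \<le> h i j" if "3 \<le> i" "i < k" "2 \<le> j" "j < k" "even i \<Longrightarrow> j < k - 1" for i j
    using that by (intro zero) (auto simp: zero_indices_def)
  have zk: "h (k - 1) j \<le> real (j div 2)" if "odd j" "3 \<le> j" "j < k" for j
  proof -
    \<comment> \<open>For odd \<open>k\<close> the index \<open>k - 1\<close> is even, so stopping
      at \<open>k - 2\<close> omits no odd \<open>j\<close>.\<close>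
    have "even k \<or> j \<noteq> k - 1" using that by auto
    then have "(k, j) \<in> zero_indices k" using that by (auto simp: zero_indices_def)
    from zero[OF this] show ?thesis using last[of j] sym[of k j] that by simp
  qed
  have o: "h i j \<le> h (i - 1) j + 1" if "4 \<le> i" "i < k" "4 \<le> j" "j < k" "odd i \<Longrightarrow> j < k - 1" for i j
    using that by (intro one) (auto simp: one_indices_def)
  have ok: "real (j div 2) - 1 \<le> h (k - 1) j" if "even j" "4 \<le> j" "j < k" for j
  proof -
    have "odd k \<or> j \<noteq> k - 1" using that by auto
    then have "(k, j) \<in> one_indices k" using that by (auto simp: one_indices_def)
    from one[OF this] show ?thesis using last[of j] sym[of k j] that by simp
  qed
  have col2: "0 \<le> h i 2" if "2 \<le> i" "i < k" for i
    using that
  proof (induction i rule: nat_induct_at_least)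
    case base
    then show ?case using z22 by simp
  next
    case (Suc i)
    then show ?case using z[of "Suc i" 2] \<open>2 < k - 1\<close> by simp
  qed
  \<comment> \<open>An even \<open>j\<close> borrows the bound of \<open>j + 1\<close>, which has
    the same half. For \<open>j = k - 1\<close> that neighbour is the boundary, so the diagonal
    upper bound at \<open>(j, j)\<close> is used with the bound for \<open>j - 1\<close>.\<close>
  have zk_even: "h (k - 1) j \<le> real (j div 2)" if "even j" "2 \<le> j" "j < k" for j
  proof (cases "j = k - 1")
    case True
    have "4 \<le> j" using that True k by presburger
    have "h j j \<le> h (j - 1) j + 1" using o[of j j] that \<open>4 \<le> j\<close> by simp
    moreover have "h j (j - 1) \<le> real ((j - 1) div 2)"
      using zk[of "j - 1"] that True \<open>4 \<le> j\<close> by simp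
    moreover have "real ((j - 1) div 2) = real (j div 2) - 1"
      using pred_half that by simp
    ultimately show ?thesis using sym[of j "j - 1"] True by simp
  next
    case False
    have "h j (k - 1) \<le> h (j + 1) (k - 1)" using z[of "j + 1" "k - 1"] that False k by simp
    moreover have "h (k - 1) (j + 1) \<le> real ((j + 1) div 2)" using zk[of "j + 1"] that False by simp
    moreover have "(j + 1) div 2 = j div 2" using that by simp
    ultimately show ?thesis using sym[of "k - 1" j] sym[of "k - 1" "j + 1"] by simp
  qed
  \<comment> \<open>An odd \<open>j\<close> borrows the bound of \<open>j - 1\<close>, which has the
    same half; for \<open>j = 3\<close> this is the non-negativity of column 2.\<close>
  have ok_odd: "real (j div 2) - 1 \<le> h (k - 1) j" if "odd j" "3 \<le> j" "j < k" for j
  proof -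
    have "h (k - 1) (j - 1) \<le> h (k - 1) j"
      using z[of j "k - 1"] that k sym[of "k - 1"] by simp
    moreover have "real ((j - 1) div 2) - 1 \<le> h (k - 1) (j - 1)"
    proof (cases "j = 3")
      case True
      then show ?thesis using col2[of "k - 1"] k by simp
    next
      case False
      with that have "4 \<le> j - 1" by presburger
      then show ?thesis using ok[of "j - 1"] that by simp
    qed
    moreover have "(j - 1) div 2 = j div 2" using that by (auto elim!: oddE)
    ultimately show ?thesis by simp
  qed
  have upper: "h (k - 1) j \<le> real (j div 2)" if "2 \<le> j" "j < k" for j
    using that zk[of j] zk_even[of j] by (cases "even j"; cases "j = 2") (auto intro: Suc_leI)
  have lower: "real (j div 2) - 1 \<le> h (k - 1) j" if "2 \<le> j" "j < k" for j
  proof (cases "j = 2")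
    case True
    then show ?thesis using col2[of "k - 1"] k by simp
  next
    case False
    then have "even j \<Longrightarrow> 4 \<le> j" "odd j \<Longrightarrow> 3 \<le> j" using that by presburger+
    then show ?thesis using that ok[of j] ok_odd[of j] by blast
  qed
  have mono: "h (i - 1) j \<le> h i j" if "2 \<le> i" "i \<le> k" "2 \<le> j" "j < k" for i j
  proof -
    have "i = 2 \<or> i = k \<or> 3 \<le> i \<and> i < k" "j = k - 1 \<or> j < k - 1" using that by auto
    then consider "i = 2" | "i = k" | "3 \<le> i" "i < k" "even i" "j = k - 1"
      | "3 \<le> i" "i < k" "even i \<longrightarrow> j < k - 1"
      by blast
    then show ?thesis
    proof cases
      case 1
      then show ?thesis using col2[of j] first[of j] sym[of 2 j] that by simp
    next
      case 2
      then show ?thesis using upper[of j] last[of j] sym[of k j] that by simp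
    next
      \<comment> \<open>The unlisted even rows in column \<open>k - 1\<close>: the half drops by one
        from \<open>i\<close> to \<open>i - 1\<close>, so the ranges allowed in row
        \<open>k - 1\<close> meet in one point.\<close>
      case 3
      have "real (i div 2) - 1 \<le> h (k - 1) i" using lower[of i] 3 by simp
      moreover have "h (k - 1) (i - 1) \<le> real ((i - 1) div 2)" using upper[of "i - 1"] 3 by simp
      moreover have "real ((i - 1) div 2) = real (i div 2) - 1" using pred_half 3 by simp
      ultimately show ?thesis using sym[of "k - 1" i] sym[of "k - 1" "i - 1"] 3 by simp
    next
      case 4
      then show ?thesis using z that by simp
    qed
  qed
  have le_last: "h i j \<le> real (i div 2)" if "1 \<le> i" "i < k" "2 \<le> j" "j < k" for i j
  proof -
    have "j \<le> m \<Longrightarrow> m \<le> k \<Longrightarrow> h i j \<le> h i m" for m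
    proof (induction m rule: dec_induct)
      case (step m)
      moreover have "h m i \<le> h (Suc m) i"
      proof (cases "i = 1")
        case True
        then show ?thesis using first[of m] first[of "Suc m"] sym[of 1] step that by simp
      next
        case False
        then show ?thesis using mono[of "Suc m" i] step that by simp
      qed
      ultimately show ?case using sym[of i m] sym[of i "Suc m"] by simp
    qed simp
    from this[of k] show ?thesis using last[of i] that by simp
  qed
  have nonneg: "0 \<le> h i j" if "1 \<le> i" "i \<le> k" "2 \<le> j" "j < k" for i j
    using that
  proof (induction i rule: nat_induct_at_least)
    case base
    then show ?case using first[of j] by simp
  next
    case (Suc i)
    then show ?case using mono[of "Suc i" j] by simp
  qed
  have step: "h i j \<le> h (i - 1) j + 1" if "2 \<le> i" "i \<le> k" "2 \<le> j" "j < k" for i j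
  proof -
    have pred: "1 \<le> i - 1" "i - 1 \<le> k" using that by simp_all
    have "i = k \<or> i < k \<and> i \<le> 3 \<or> i < k \<and> 4 \<le> i" "j \<le> 3 \<or> 4 \<le> j" "j = k - 1 \<or> j < k - 1"
      using that by auto
    then consider "i = k" | "i < k" "i \<le> 3" | "j \<le> 3" "i < k" | "4 \<le> i" "i < k" "odd i" "j = k - 1"
      | "4 \<le> i" "i < k" "4 \<le> j" "odd i \<longrightarrow> j < k - 1"
      by blast
    then show ?thesis
    proof cases
      case 1
      then show ?thesis using lower[of j] last[of j] sym[of k j] that by simp
    next
      case 2
      \<comment> \<open>When \<open>i\<close> or \<open>j\<close> is at most 3, its half is at most
        1, so both values lie between 0 and 1 and cannot differ by more than one.\<close>
      then have "real (i div 2) \<le> 1" using that by simp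
      then show ?thesis using le_last[of i j] nonneg[of "i - 1" j, OF pred] 2 that by simp
    next
      case 3
      have "h i j \<le> real (j div 2)" using le_last[of j i] sym[of i j] 3 that by simp
      moreover have "real (j div 2) \<le> 1" using 3 by simp
      ultimately show ?thesis using nonneg[of "i - 1" j, OF pred] 3 that by simp
    next
      case 4
      have "h i j \<le> real (i div 2)" using le_last[of i j] 4 that by simp
      moreover have "real ((i - 1) div 2) - 1 \<le> h (k - 1) (i - 1)" using lower[of "i - 1"] 4 by simp
      moreover have "(i - 1) div 2 = i div 2" using 4 by (auto elim!: oddE)
      ultimately show ?thesis using sym[of "k - 1" "i - 1"] 4 by simp
    next
      case 5
      then show ?thesis using o that by simp
    qed
  qed
  consider "j = 1" | "j = k" | "2 \<le> j" "j < k" using j by linarith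
  then show ?thesis
  proof cases
    case 1
    then show ?thesis using first[of i] first[of "i - 1"] sym[of _ 1] i by simp
  next
    case 2
    have "(i - 1) div 2 \<le> i div 2" "i div 2 \<le> (i - 1) div 2 + 1" by linarith+
    then show ?thesis using last[of i] last[of "i - 1"] i 2 by simp
  next
    case 3
    then show ?thesis using mono step i by simp
  qed
qed

lemma zero_indices_bounds: "(i, j) \<in> zero_indices k \<Longrightarrow> 4 \<le> k \<Longrightarrow> 2 \<le> i \<and> i \<le> k \<and> 2 \<le> j \<and> j < k"
  and one_indices_bounds: "(i, j) \<in> one_indices k \<Longrightarrow> 4 \<le> k \<Longrightarrow> 2 \<le> i \<and> i \<le> k \<and> 2 \<le> j \<and> j < k"
  by (auto simp: zero_indices_def one_indices_def)

lemma zero_indices_cases: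
  assumes "(i, j) \<in> zero_indices k" "4 \<le> k"
  shows "i = 2 \<and> j = 2 \<or>
    3 \<le> int i \<and> int i \<le> int k - 1 \<and> 2 \<le> int j \<and> int j \<le> int k - 1 \<and> (even (int i) \<longrightarrow> int j \<le> int k - 2) \<or>
    int i = int k \<and> odd (int j) \<and> 3 \<le> int j \<and> int j \<le> int k - 1"
  using assms by (auto simp: zero_indices_def)

lemma one_indices_cases:
  assumes "(i, j) \<in> one_indices k" "4 \<le> k"
  shows "4 \<le> int i \<and> int i \<le> int k - 1 \<and> 4 \<le> int j \<and> int j \<le> int k - 1 \<and> (odd (int i) \<longrightarrow> int j \<le> int k - 2) \<or>
    int i = int k \<and> even (int j) \<and> 4 \<le> int j \<and> int j \<le> int k - 1"
  using assms by (auto simp: one_indices_def)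

section \<open>Counting the listed constraints\<close>

lemma finite_indices: "finite (zero_indices k)" "finite (one_indices k)"
proof -
  have "finite {(i, j). i \<in> {3..k - 1} \<and> j \<in> {2..k - 1 - of_bool (even i)}}"
    by (rule finite_subset[of _ "{..k} \<times> {..k}"]) auto
  then show "finite (zero_indices k)" by (simp add: zero_indices_def)
  have "finite {(i, j). i \<in> {4..k - 1} \<and> j \<in> {4..k - 1 - of_bool (odd i)}}"
    by (rule finite_subset[of _ "{..k} \<times> {..k}"]) auto
  then show "finite (one_indices k)" by (simp add: one_indices_def)
qed

text \<open>Both sets are full rectangles corrected by the even and odd indices \<open>E\<close> and
  \<open>D\<close> of \<open>{4..k - 1}\<close>. The corrections enter the two cardinalities with
  opposite signs and cancel, leaving the two rectangles and the extra cells \<open>(2, 2)\<close>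
  and \<open>(k, 3)\<close>.\<close>

lemma card_indices:
  assumes k: "4 \<le> k"
  shows "card (zero_indices k) + card (one_indices k) = 2 + (k - 3) * (k - 2) + (k - 4) * (k - 4)"
proof -
  define E where "E = {i \<in> {4..k - 1}. even i}"
  define D where "D = {i \<in> {4..k - 1}. odd i}"
  have fin: "finite E" "finite D" by (simp_all add: E_def D_def)
  have eq: "zero_indices k = insert (2, 2) (({3..k - 1} \<times> {2..k - 1} - E \<times> {k - 1}) \<union> {k} \<times> insert 3 D)"
  proof (rule set_eqI)
    fix p :: "nat \<times> nat"
    obtain i j where p: "p = (i, j)" by force
    have "3 \<le> i \<and> i \<le> k - 1 \<and> 2 \<le> j \<and> j \<le> k - 1 - of_bool (even i) \<longleftrightarrow>
        3 \<le> i \<and> i \<le> k - 1 \<and> 2 \<le> j \<and> j \<le> k - 1 \<and> \<not> (4 \<le> i \<and> i \<le> k - 1 \<and> even i \<and> j = k - 1)"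
    proof (cases "even i")
      case True
      then have "i \<noteq> 3" by auto
      then show ?thesis using True by auto
    qed simp
    moreover have "3 \<le> j \<and> j \<le> k - 1 - of_bool (odd k) \<and> odd j \<longleftrightarrow> j = 3 \<or> 4 \<le> j \<and> j \<le> k - 1 \<and> odd j"
    proof (cases "odd j")
      case True
      then have "j \<le> k - 1 - of_bool (odd k) \<longleftrightarrow> j \<le> k - 1"
        using k by (cases "odd k") (auto, presburger)
      then show ?thesis using True k by auto
    qed auto
    moreover have "p \<in> zero_indices k \<longleftrightarrow> i = 2 \<and> j = 2 \<or>
        (3 \<le> i \<and> i \<le> k - 1 \<and> 2 \<le> j \<and> j \<le> k - 1 - of_bool (even i)) \<or>
        i = k \<and> (3 \<le> j \<and> j \<le> k - 1 - of_bool (odd k) \<and> odd j)"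
      unfolding p zero_indices_def Un_iff mem_Sigma_iff mem_Collect_eq case_prod_conv atLeastAtMost_iff
        singleton_iff prod.inject by argo
    moreover have "p \<in> insert (2, 2) (({3..k - 1} \<times> {2..k - 1} - E \<times> {k - 1}) \<union> {k} \<times> insert 3 D) \<longleftrightarrow>
        i = 2 \<and> j = 2 \<or> (3 \<le> i \<and> i \<le> k - 1 \<and> 2 \<le> j \<and> j \<le> k - 1 \<and> \<not> (4 \<le> i \<and> i \<le> k - 1 \<and> even i \<and> j = k - 1)) \<or>
        i = k \<and> (j = 3 \<or> 4 \<le> j \<and> j \<le> k - 1 \<and> odd j)"
      unfolding p E_def D_def Un_iff mem_Sigma_iff mem_Collect_eq Diff_iff insert_iff atLeastAtMost_iff
        empty_iff prod.inject by argo
    ultimately show "p \<in> zero_indices k \<longleftrightarrow>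
        p \<in> insert (2, 2) (({3..k - 1} \<times> {2..k - 1} - E \<times> {k - 1}) \<union> {k} \<times> insert 3 D)"
      by argo
  qed
  have finB: "finite (({3..k - 1} \<times> {2..k - 1} - E \<times> {k - 1}) \<union> {k} \<times> insert 3 D)"
    using fin by auto
  have notin: "(2, 2) \<notin> ({3..k - 1} \<times> {2..k - 1} - E \<times> {k - 1}) \<union> {k} \<times> insert 3 D"
    using k by auto
  have "card (zero_indices k) =
      Suc (card (({3..k - 1} \<times> {2..k - 1} - E \<times> {k - 1}) \<union> {k} \<times> insert 3 D))"
    using eq card_insert_disjoint[OF finB notin] by (simp only:)
  moreover have "card (({3..k - 1} \<times> {2..k - 1} - E \<times> {k - 1}) \<union> {k} \<times> insert 3 D) =
      card ({3..k - 1} \<times> {2..k - 1} - E \<times> {k - 1}) + card ({k} \<times> insert 3 D)"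
    using fin k by (intro card_Un_disjoint) auto
  moreover have "card ({3..k - 1} \<times> {2..k - 1} - E \<times> {k - 1}) = (k - 3) * (k - 2) - card E"
    using fin k by (subst card_Diff_subset) (auto simp: E_def card_cartesian_product)
  moreover have "card ({k} \<times> insert 3 D) = card D + 1"
    using fin by (simp add: card_cartesian_product D_def)
  ultimately have Z: "card (zero_indices k) = 1 + ((k - 3) * (k - 2) - card E) + (card D + 1)"
    by linarith
  have "one_indices k = ({4..k - 1} \<times> {4..k - 1} - D \<times> {k - 1}) \<union> {k} \<times> E"
  proof (rule set_eqI)
    fix p :: "nat \<times> nat"
    obtain i j where p: "p = (i, j)" by force
    have "j \<le> k - 1 - of_bool (even k) \<longleftrightarrow> j \<le> k - 1" if "even j"
      using that k by (cases "even k") (auto, presburger)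
    then show "p \<in> one_indices k \<longleftrightarrow> p \<in> ({4..k - 1} \<times> {4..k - 1} - D \<times> {k - 1}) \<union> {k} \<times> E"
      using k unfolding p one_indices_def E_def D_def by (cases "even i") auto
  qed
  moreover have "card (({4..k - 1} \<times> {4..k - 1} - D \<times> {k - 1}) \<union> {k} \<times> E) =
      card ({4..k - 1} \<times> {4..k - 1} - D \<times> {k - 1}) + card ({k} \<times> E)"
    using fin k by (intro card_Un_disjoint) auto
  moreover have "card ({4..k - 1} \<times> {4..k - 1} - D \<times> {k - 1}) = (k - 4) * (k - 4) - card D"
    using fin k by (subst card_Diff_subset) (auto simp: D_def card_cartesian_product)
  ultimately have O: "card (one_indices k) = (k - 4) * (k - 4) - card D + card E"
    by (simp add: card_cartesian_product)
  \<comment> \<open>These estimates ensure that the natural-number subtractions in \<open>Z\<close>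
    and \<open>O\<close> do not truncate before cancelling.\<close>
  have "E \<subseteq> {4..k - 1}" "D \<subseteq> {4..k - 1}" by (auto simp: E_def D_def)
  then have "card E \<le> k - 4" "card D \<le> k - 4"
    using card_mono[of "{4..k - 1}" E] card_mono[of "{4..k - 1}" D] by simp_all
  moreover have "k - 4 \<le> (k - 3) * (k - 2)" "k - 4 \<le> (k - 4) * (k - 4)"
    using k by (auto intro: order_trans[of _ "(k - 3) * 1"] simp: le_square)
  ultimately have "card E \<le> (k - 3) * (k - 2)" "card D \<le> (k - 4) * (k - 4)" by linarith+
  then show ?thesis using Z O by linarith
qed

section \<open>Alternating lines and symmetric alternating sign matrices\<close>

lemma nonzero_entries_Suc:
  "nonzero_entries (Suc n) f = nonzero_entries n f @ (if f (Suc n) = 0 then [] else [f (Suc n)])"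
  by (simp add: nonzero_entries_def)

abbreviation alternating_from_one :: "real list \<Rightarrow> bool" where
  "alternating_from_one xs \<equiv> (xs = [] \<or> hd xs = 1) \<and> successively (\<lambda>x y. sgn y = - sgn x) xs"

text \<open>The partial sum serves as the state of the induction: it is 1 when the last non-zero
  entry is 1 and 0 otherwise, so it decides which sign may come next. The second conjunct carries
  this state along.\<close>

lemma alternating_from_one_iff_partial_sums:
  assumes "\<forall>j\<in>{1..n}. f j \<in> {0, 1, -1}"
  shows "(alternating_from_one (nonzero_entries n f) \<longleftrightarrow> (\<forall>j\<le>n. sum f {1..j} \<in> {0, 1})) \<and>
      ((\<forall>j\<le>n. sum f {1..j} \<in> {0, 1}) \<longrightarrow>
        sum f {1..n} = (if nonzero_entries n f \<noteq> [] \<and> last (nonzero_entries n f) = 1 then 1 else 0))"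
  using assms
proof (induction n)
  case 0
  show ?case by (simp add: nonzero_entries_def)
next
  case (Suc n)
  define xs where "xs = nonzero_entries n f"
  define s where "s = sum f {1..n}"
  define B where "B \<longleftrightarrow> (\<forall>j\<le>n. sum f {1..j} \<in> {0, 1})"
  have prem: "\<forall>j\<in>{1..n}. f j \<in> {0, 1, -1}" using Suc.prems by simp
  have IH1: "alternating_from_one xs \<longleftrightarrow> B" and IH2: "B \<Longrightarrow> s = (if xs \<noteq> [] \<and> last xs = 1 then 1 else 0)"
    using Suc.IH[OF prem] unfolding xs_def B_def s_def by blast+
  have entries: "x = 1 \<or> x = -1" if "x \<in> set xs" for x
    using that prem by (auto simp: xs_def nonzero_entries_def)
  have last: "xs = [] \<or> last xs = 1 \<or> last xs = -1"
    using entries[of "last xs"] by fastforce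
  have all: "(\<forall>j\<le>Suc n. sum f {1..j} \<in> {0, 1}) \<longleftrightarrow> B \<and> s + f (Suc n) \<in> {0, 1}"
    by (auto simp: le_Suc_eq B_def s_def)
  have sum: "sum f {1..Suc n} = s + f (Suc n)" by (simp add: s_def)
  have ne: "nonzero_entries (Suc n) f = xs @ (if f (Suc n) = 0 then [] else [f (Suc n)])"
    by (simp add: nonzero_entries_Suc xs_def)
  consider "f (Suc n) = 0" | "f (Suc n) = 1" | "f (Suc n) = -1" using Suc.prems by fastforce
  note f = this
  show ?case
  proof (cases B)
    case True
    with IH1 have alt: "xs = [] \<or> hd xs = 1" "successively (\<lambda>x y. sgn y = - sgn x) xs" by simp_all
    show ?thesis
    proof (cases "xs = []")
      case xs: True
      then have "s = 0" using IH2[OF True] by simp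
      with xs True f show ?thesis unfolding all sum ne by cases auto
    next
      case xs: False
      then have "s = 1 \<and> last xs = 1 \<or> s = 0 \<and> last xs = -1" using IH2[OF True] last by auto
      with f xs alt True show ?thesis unfolding all sum ne
        by cases (auto simp: successively_append_iff)
    qed
  next
    case False
    with IH1 have alt: "\<not> alternating_from_one xs" by simp
    then have "xs \<noteq> []" by auto
    with alt False show ?thesis unfolding all sum ne by (auto simp: successively_append_iff)
  qed
qed

lemma alternating_line_iff_partial_sums:
  assumes "\<forall>j\<in>{1..n}. f j \<in> {0, 1, -1}"
  shows "alternating_line n f \<longleftrightarrow> (\<forall>j\<le>n. sum f {1..j} \<in> {0, 1}) \<and> sum f {1..n} = 1"
proof -
  have "alternating_line n f \<longleftrightarrow> alternating_from_one (nonzero_entries n f) \<and>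
      nonzero_entries n f \<noteq> [] \<and> last (nonzero_entries n f) = 1"
    unfolding alternating_line_def by blast
  with alternating_from_one_iff_partial_sums[OF assms] show ?thesis
    by (metis zero_neq_one)
qed

section \<open>Row sums forced by the symmetries\<close>

lemma tsasm_entry_symmetries:
  assumes "tsasm n X" "i \<in> {1..n}" "j \<in> {1..n}"
  shows "X i j = X j i" "X i (n + 1 - j) = X i j"
  using assms unfolding tsasm_def by metis+

lemma sum_pred:
  fixes f :: "nat \<Rightarrow> real"
  shows "1 \<le> j \<Longrightarrow> sum f {1..j} = sum f {1..j - 1} + f j"
  by (cases j) simp_all

lemma tsasm_row:
  assumes X: "tsasm n X" and i: "i \<in> {1..n}"
  shows "\<And>j. j \<le> n \<Longrightarrow> sum (X i) {1..j} \<in> {0, 1}" and "sum (X i) {1..n} = 1"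
proof -
  have "\<forall>j\<in>{1..n}. X i j \<in> {0, 1, -1}" "alternating_line n (X i)"
    using X i unfolding tsasm_def asm_def by blast+
  then show "\<And>j. j \<le> n \<Longrightarrow> sum (X i) {1..j} \<in> {0, 1}" and "sum (X i) {1..n} = 1"
    using alternating_line_iff_partial_sums[of n "X i"] by blast+
qed

text \<open>Past the middle entry the line repeats itself backwards, so every later partial sum is
  determined by those of the left half.\<close>

lemma sum_symmetric_half:
  fixes f :: "nat \<Rightarrow> real"
  assumes "\<And>j. j \<in> {1..2 * k + 1} \<Longrightarrow> f (2 * k + 2 - j) = f j" and "t \<le> k"
  shows "sum f {1..k + 1 + t} = 2 * sum f {1..k} + f (k + 1) - sum f {1..k - t}"
  using \<open>t \<le> k\<close>
proof (induction t)
  case 0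
  then show ?case by simp
next
  case (Suc t)
  have "k - t \<in> {1..2 * k + 1}" "2 * k + 2 - (k - t) = k + 1 + Suc t" using Suc.prems by auto
  then have "f (k + 1 + Suc t) = f (k - t)"
    using assms(1)[of "k - t"] by simp
  moreover have "sum f {1..k - t} = sum f {1..k - Suc t} + f (k - t)"
    using sum_pred[of "k - t" f] Suc.prems by simp
  ultimately show ?case using Suc by simp
qed

lemma tsasm_middle_column:
  assumes X: "tsasm n X" and n: "n = 2 * k + 1" and i: "i \<in> {1..n}"
  shows "X i (k + 1) = 1 - 2 * sum (X i) {1..k}"
proof -
  have "X i (2 * k + 2 - j) = X i j" if "j \<in> {1..2 * k + 1}" for j
    using tsasm_entry_symmetries(2)[OF X i, of j] that n by simp
  from sum_symmetric_half[of k "X i" k, OF this]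
  have "sum (X i) {1..k + 1 + k} = 2 * sum (X i) {1..k} + X i (k + 1) - sum (X i) {1..k - k}"
    by simp
  moreover have "k + 1 + k = n" using n by simp
  then have "sum (X i) {1..k + 1 + k} = 1" using tsasm_row(2)[OF X i] by simp
  moreover have "sum (X i) {1..k - k} = 0" by simp
  ultimately show ?thesis by linarith
qed

text \<open>The entries of the middle column are odd by \<open>tsasm_middle_column\<close>, hence 1
  or -1. By symmetry they also form the middle row, whose partial sums stay in
  \<open>{0, 1}\<close>; so they alternate starting from 1, and this fixes all half sums.\<close>

lemma tsasm_row_half_sum:
  assumes X: "tsasm n X" and n: "n = 2 * k + 1" and i: "i \<in> {1..n}"
  shows "sum (X i) {1..k} = (if even i then 1 else 0)"
proof -
  have col: "X i (k + 1) = X (k + 1) i" if "i \<in> {1..n}" for i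
    using tsasm_entry_symmetries(1)[OF X that, of "k + 1"] n by simp
  have pm: "X (k + 1) i \<in> {1, -1}" if "i \<in> {1..n}" for i
    using tsasm_middle_column[OF X n that] tsasm_row(1)[OF X that, of k] col[OF that] n by auto
  have "sum (X (k + 1)) {1..i} = (if odd i then 1 else 0)" if "i \<le> n" for i
    using that
  proof (induction i)
    case 0
    then show ?case by simp
  next
    case (Suc i)
    then show ?case
      using pm[of "Suc i"] tsasm_row(1)[OF X, of "k + 1" "Suc i"] n by (auto split: if_splits)
  qed
  from this[of i] this[of "i - 1"] have "X (k + 1) i = (if odd i then 1 else -1)"
    using i by (cases i) (auto split: if_splits)
  then show ?thesis
    using tsasm_middle_column[OF X n i] col[OF i] by (auto split: if_splits)
qed

section \<open>The core polytope\<close>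

locale core_space =
  fixes n k :: nat and pos :: "'c::finite \<Rightarrow> nat \<times> nat"
  assumes k_def: "k = n div 2" and pos: "bij_betw pos UNIV (core_positions n)"
begin

section \<open>Corner sums as coordinates\<close>

lemma inv_pos: "pos (inv pos p) = p" if "p \<in> core_positions n"
  using pos that by (metis bij_betw_imp_surj_on f_inv_into_f)

definition sym_entry :: "real ^ 'c \<Rightarrow> nat \<Rightarrow> nat \<Rightarrow> real" where
  "sym_entry Y i j = entry pos Y (min i j) (max i j)"

definition corner_sum :: "real ^ 'c \<Rightarrow> nat \<Rightarrow> nat \<Rightarrow> real" where
  "corner_sum Y i j = (\<Sum>i'=1..i. \<Sum>j'=1..j. sym_entry Y i' j')"

lemma sym_entry_commute: "sym_entry Y i j = sym_entry Y j i"
  by (simp add: sym_entry_def min.commute max.commute)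

lemma L_eq_sum: "L pos i j Y = (\<Sum>j'=1..j. sym_entry Y i j')"
proof -
  have "{1..j} = {1..min i j} \<union> {i + 1..j}" by auto
  then have "(\<Sum>j'=1..j. sym_entry Y i j') =
      (\<Sum>j'=1..min i j. sym_entry Y i j') + (\<Sum>j'=i + 1..j. sym_entry Y i j')"
    by (simp add: sum.union_disjoint)
  also have "(\<Sum>j'=1..min i j. sym_entry Y i j') = (\<Sum>i'=1..min i j. entry pos Y i' i)"
    by (intro sum.cong) (auto simp: sym_entry_def)
  also have "(\<Sum>j'=i + 1..j. sym_entry Y i j') = (\<Sum>j'=i + 1..j. entry pos Y i j')"
    by (intro sum.cong) (auto simp: sym_entry_def)
  finally show ?thesis by (simp add: L_def)
qed

lemma corner_sum_commute: "corner_sum Y i j = corner_sum Y j i"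
  unfolding corner_sum_def by (subst sum.swap) (simp add: sym_entry_commute)

lemma corner_sum_0: "corner_sum Y 0 j = 0" "corner_sum Y j 0 = 0"
  by (simp_all add: corner_sum_def)

lemma corner_sum_Suc: "corner_sum Y (Suc i) j = corner_sum Y i j + L pos (Suc i) j Y"
  by (simp add: corner_sum_def L_eq_sum)

lemma L_eq_diff: "1 \<le> i \<Longrightarrow> L pos i j Y = corner_sum Y i j - corner_sum Y (i - 1) j"
  using corner_sum_Suc[of Y "i - 1" j] by simp

lemma linear_sym_entry: "linear (\<lambda>Y. sym_entry Y i j)"
  unfolding sym_entry_def entry_def by (rule linearI) simp_all

lemma linear_corner_sum: "linear (\<lambda>Y. corner_sum Y i j)"
  unfolding corner_sum_def by (intro linear_compose_sum ballI linear_sym_entry)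

lemma linear_L: "linear (L pos i j)"
  using linear_compose_sum[of "{1..j}" "\<lambda>j' Y. sym_entry Y i j'"] linear_sym_entry
  by (simp add: L_eq_sum[abs_def])

text \<open>Mixed second differences invert corner summation. The guard in \<open>g\<close> supplies
  zeros in row and column 0, where \<open>h\<close> may take any value.\<close>

definition of_corner_sums :: "(nat \<Rightarrow> nat \<Rightarrow> real) \<Rightarrow> real ^ 'c" where
  "of_corner_sums h = (\<chi> c. let (i, j) = pos c; g = (\<lambda>p q. if p = 0 \<or> q = 0 then 0 else h p q) in
     g i j - g (i - 1) j - g i (j - 1) + g (i - 1) (j - 1))"

lemma corner_sum_of_corner_sums:
  assumes sym: "\<And>p q. h p q = h q p" and ij: "1 \<le> i" "i \<le> k" "1 \<le> j" "j \<le> k"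
  shows "corner_sum (of_corner_sums h) i j = h i j"
proof -
  define g where "g p q = (if p = 0 \<or> q = 0 then 0 else h p q)" for p q
  have g_sym: "g p q = g q p" for p q using sym by (simp add: g_def)
  have e: "sym_entry (of_corner_sums h) i j = g i j - g (i - 1) j - g i (j - 1) + g (i - 1) (j - 1)"
    if "1 \<le> i" "i \<le> k" "1 \<le> j" "j \<le> k" for i j
  proof -
    have "(min i j, max i j) \<in> core_positions n"
      using that by (auto simp: core_positions_def k_def)
    then have "sym_entry (of_corner_sums h) i j = g (min i j) (max i j) - g (min i j - 1) (max i j)
        - g (min i j) (max i j - 1) + g (min i j - 1) (max i j - 1)"
      by (simp add: sym_entry_def entry_def of_corner_sums_def inv_pos g_def Let_def)
    then show ?thesis
      using g_sym by (cases "i \<le> j") (simp_all add: min_def max_def)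
  qed
  have row: "(\<Sum>j'=1..j. sym_entry (of_corner_sums h) i j') = g i j - g (i - 1) j"
    if "1 \<le> i" "i \<le> k" "j \<le> k" for i j
    using that
  proof (induction j)
    case 0
    then show ?case by (simp add: g_def)
  next
    case (Suc j)
    then show ?case using e[of i "Suc j"] by simp
  qed
  have "i \<le> k \<Longrightarrow> corner_sum (of_corner_sums h) i j = g i j" for i
  proof (induction i)
    case 0
    then show ?case by (simp add: g_def corner_sum_0)
  next
    case (Suc i)
    then show ?case using row[of "Suc i" j] ij by (simp add: corner_sum_Suc L_eq_sum)
  qed
  then show ?thesis using ij by (simp add: g_def)
qed

lemma entry_core:
  assumes "1 \<le> i" "i \<le> k" "1 \<le> j" "j \<le> k" and "\<And>i j. i \<in> {1..k} \<Longrightarrow> j \<in> {1..k} \<Longrightarrow> X i j = X j i"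
  shows "sym_entry (core pos X) i j = X i j"
proof -
  have "(min i j, max i j) \<in> core_positions n"
    using assms by (auto simp: core_positions_def k_def)
  then show ?thesis
    using assms by (cases "i \<le> j") (simp_all add: sym_entry_def entry_def core_def inv_pos min_def max_def)
qed

lemma eqI_sym_entry:
  assumes "\<And>i j. 1 \<le> i \<Longrightarrow> i \<le> k \<Longrightarrow> 1 \<le> j \<Longrightarrow> j \<le> k \<Longrightarrow> sym_entry Y i j = sym_entry Z i j"
  shows "Y = Z"
proof (rule vec_eq_iff[THEN iffD2], rule allI)
  fix c
  obtain i j where ij: "pos c = (i, j)" by force
  have "pos c \<in> core_positions n" using pos by (auto simp: bij_betw_def)
  then have b: "1 \<le> i" "i \<le> j" "j \<le> k" using ij by (auto simp: core_positions_def k_def)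
  have "inv pos (i, j) = c" using pos ij by (metis bij_betw_imp_inj_on inv_f_eq)
  then show "Y $ c = Z $ c"
    using assms[of i j] b by (simp add: sym_entry_def entry_def min_def max_def)
qed

section \<open>The relaxation as a compact convex set\<close>

definition boundary_space :: "(real ^ 'c) set" where
  "boundary_space = (\<Inter>j\<in>{1..k}. (\<lambda>Y. corner_sum Y 1 j) -` {0} \<inter> (\<lambda>Y. corner_sum Y j k) -` {real (j div 2)})"

definition relaxation :: "(real ^ 'c) set" where
  "relaxation = boundary_space \<inter> (\<Inter>i\<in>{2..k}. \<Inter>j\<in>{1..k}. L pos i j -` {0..1})"

lemma affine_boundary_space: "affine boundary_space"
proof -
  have "affine (f -` {c})" if "linear f" for f :: "real ^ 'c \<Rightarrow> real" and c
    using that by (auto simp: affine_def linear_add linear_scale simp flip: distrib_right)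
  then show ?thesis
    unfolding boundary_space_def INT_extend_simps
    by (intro affine_Inter) (auto intro!: affine_Int linear_corner_sum)
qed

lemma convex_relaxation: "convex relaxation"
  unfolding relaxation_def boundary_space_def
  by (intro convex_Int convex_INT convex_linear_vimage linear_corner_sum linear_L) simp_all

lemma relaxation_L_bounds:
  assumes "Y \<in> relaxation" "1 \<le> i" "i \<le> k" "j \<le> k"
  shows "L pos i j Y \<in> {0..1}"
proof (cases "j = 0")
  case True
  then show ?thesis by (simp add: L_eq_sum)
next
  case j: False
  show ?thesis
  proof (cases "i = 1")
    case True
    then have "L pos i j Y = corner_sum Y 1 j" by (simp add: L_eq_diff corner_sum_0)
    then show ?thesis using assms j by (simp add: relaxation_def boundary_space_def)
  next
    case False
    then show ?thesis using assms j by (auto simp: relaxation_def)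
  qed
qed

lemma sym_entry_eq_L_diff: "1 \<le> j \<Longrightarrow> sym_entry Y i j = L pos i j Y - L pos i (j - 1) Y"
  by (cases j) (simp_all add: L_eq_sum)

text \<open>Bounded because each coordinate is the difference of two partial row sums lying between
  0 and 1.\<close>

lemma compact_relaxation: "compact relaxation"
proof -
  have cont: "continuous_on UNIV f" if "linear f" for f :: "real ^ 'c \<Rightarrow> real"
    using that by (simp add: linear_continuous_on linear_linear)
  have "closed relaxation"
    unfolding relaxation_def boundary_space_def
    by (intro closed_Int closed_INT ballI closed_vimage cont linear_corner_sum linear_L) simp_all
  moreover have "bounded relaxation"
  proof (rule boundedI)
    fix Y assume Y: "Y \<in> relaxation"
    have "\<bar>Y $ c\<bar> \<le> 1" for c
    proof -
      obtain i j where ij: "pos c = (i, j)" by force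
      have "pos c \<in> core_positions n" using pos by (auto simp: bij_betw_def)
      then have b: "1 \<le> i" "i \<le> j" "j \<le> k" using ij by (auto simp: core_positions_def k_def)
      have "inv pos (i, j) = c" using pos ij by (metis bij_betw_imp_inj_on inv_f_eq)
      then have "Y $ c = sym_entry Y i j"
        using b by (simp add: sym_entry_def entry_def min_def max_def)
      moreover have "j - 1 \<le> k" "i \<le> k" using b by simp_all
      ultimately show ?thesis
        using relaxation_L_bounds[OF Y, of i j] relaxation_L_bounds[OF Y, of i "j - 1"] b
        by (simp add: sym_entry_eq_L_diff abs_le_iff)
    qed
    then have "(\<Sum>c\<in>UNIV. \<bar>Y $ c\<bar>) \<le> (\<Sum>c\<in>(UNIV :: 'c set). 1)"
      by (intro sum_mono) simp
    then show "norm Y \<le> real CARD('c)"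
      using norm_le_l1_cart[of Y] by simp
  qed
  ultimately show ?thesis by (simp add: compact_eq_bounded_closed)
qed

text \<open>
  All bounds and boundary values are integers and each constraint compares only two corner sums, so
  all corner sums with one common fractional part can be shifted together in either direction.
\<close>

lemma extreme_point_integral:
  assumes ext: "Y extreme_point_of relaxation" and ij: "1 \<le> i" "i \<le> k" "1 \<le> j" "j \<le> k"
  shows "corner_sum Y i j \<in> \<int>"
proof (rule ccontr)
  assume nonint: "corner_sum Y i j \<notin> \<int>"
  define f where "f = frac (corner_sum Y i j)"
  have f: "f \<noteq> 0" using nonint by (simp add: f_def)
  define d where "d p q = (if frac (corner_sum Y p q) = f then 1 else 0 :: real)" for p q
  define D where "D = of_corner_sums d"
  \<comment> \<open>The value 1 for tight constraints is a harmless default: a tight constraint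
    joins two corner sums with equal fractional parts, which move together.\<close>
  define slack where "slack p q = (if 0 < L pos p q Y \<and> L pos p q Y < 1
     then min (L pos p q Y) (1 - L pos p q Y) else 1)" for p q
  define \<epsilon> where "\<epsilon> = Min (insert 1 (case_prod slack ` ({2..k} \<times> {1..k})))"
  have "0 < \<epsilon>" unfolding \<epsilon>_def by (subst Min_gr_iff) (auto simp: slack_def)
  have \<epsilon>: "\<epsilon> \<le> slack p q" if "p \<in> {2..k}" "q \<in> {1..k}" for p q
    unfolding \<epsilon>_def using that by (intro Min_le) auto
  have Y: "Y \<in> relaxation" using ext by (simp add: extreme_point_of_def)
  have D: "corner_sum D p q = d p q" if "1 \<le> p" "p \<le> k" "1 \<le> q" "q \<le> k" for p q
    unfolding D_def using that by (intro corner_sum_of_corner_sums) (simp_all add: d_def corner_sum_commute)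
  have shift: "corner_sum (Y + s *\<^sub>R D) p q = corner_sum Y p q + s * d p q"
    if "1 \<le> p" "p \<le> k" "1 \<le> q" "q \<le> k" for s p q
    using D[OF that] by (simp add: linear_add[OF linear_corner_sum] linear_scale[OF linear_corner_sum])
  have in_relaxation: "Y + s *\<^sub>R D \<in> relaxation" if s: "\<bar>s\<bar> \<le> \<epsilon>" for s
    unfolding relaxation_def
  proof (intro IntI INT_I)
    have "corner_sum (Y + s *\<^sub>R D) 1 q = 0 \<and> corner_sum (Y + s *\<^sub>R D) q k = real (q div 2)"
      if "q \<in> {1..k}" for q
    proof -
      have *: "corner_sum Y 1 q = 0" "corner_sum Y q k = real (q div 2)"
        using Y that by (auto simp: relaxation_def boundary_space_def)
      then have "frac (corner_sum Y 1 q) = 0" "frac (corner_sum Y q k) = 0"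
        by (simp_all del: of_nat_div add: frac_eq_0_iff)
      \<comment> \<open>Boundary values are integers and \<open>f \<noteq> 0\<close>, so they are
        never shifted.\<close>
      then have "d 1 q = 0" "d q k = 0" using f by (auto simp: d_def simp del: frac_eq_0_iff)
      then show ?thesis using shift that * by simp
    qed
    then show "Y + s *\<^sub>R D \<in> boundary_space" by (simp add: boundary_space_def)
  next
    fix p q assume pq: "p \<in> {2..k}" "q \<in> {1..k}"
    have L: "L pos p q Y = corner_sum Y p q - corner_sum Y (p - 1) q"
      using pq by (intro L_eq_diff) simp
    have Lb: "0 \<le> L pos p q Y" "L pos p q Y \<le> 1"
      using relaxation_L_bounds[OF Y, of p q] pq by auto
    have "1 \<le> p - 1" "p - 1 \<le> k" using pq by auto
    have L': "L pos p q (Y + s *\<^sub>R D) = L pos p q Y + s * (d p q - d (p - 1) q)"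
      using pq shift[of p q s] shift[of "p - 1" q s] \<open>1 \<le> p - 1\<close> \<open>p - 1 \<le> k\<close>
      by (simp add: L_eq_diff algebra_simps)
    have "0 \<le> L pos p q (Y + s *\<^sub>R D) \<and> L pos p q (Y + s *\<^sub>R D) \<le> 1"
    proof (cases "d p q = d (p - 1) q")
      case True
      then show ?thesis using L' Lb by simp
    next
      case False
      \<comment> \<open>Exactly one of the two corner sums moves, so their fractional parts differ.
        Hence \<open>L\<close> is not an integer here and has slack at least
        \<open>\<epsilon>\<close> on both sides.\<close>
      then have ne: "frac (corner_sum Y p q) \<noteq> frac (corner_sum Y (p - 1) q)"
        by (auto simp: d_def split: if_splits)
      have "L pos p q Y \<noteq> 0" using ne L by auto
      moreover have "L pos p q Y \<noteq> 1"
      proof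
        assume "L pos p q Y = 1"
        then have "corner_sum Y p q = corner_sum Y (p - 1) q + 1" using L by simp
        then show False using ne by (simp add: frac_1_eq)
      qed
      ultimately have "slack p q = min (L pos p q Y) (1 - L pos p q Y)"
        using Lb by (simp add: slack_def)
      then have "\<bar>s\<bar> \<le> L pos p q Y" "\<bar>s\<bar> \<le> 1 - L pos p q Y"
        using \<epsilon>[OF pq] s by auto
      moreover have "d p q - d (p - 1) q = 1 \<or> d p q - d (p - 1) q = -1"
        using False by (auto simp: d_def split: if_splits)
      ultimately show ?thesis using L' by auto
    qed
    then show "Y + s *\<^sub>R D \<in> L pos p q -` {0..1}" by simp
  qed
  have "corner_sum D i j = 1" using D ij by (simp add: d_def f_def)
  then have "D \<noteq> 0" using linear_0[OF linear_corner_sum[of i j]] by auto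
  have "midpoint (Y + (- \<epsilon>) *\<^sub>R D) (Y + \<epsilon> *\<^sub>R D) = Y"
    by (simp add: midpoint_def scaleR_2[symmetric])
  moreover have "Y + (- \<epsilon>) *\<^sub>R D \<noteq> Y + \<epsilon> *\<^sub>R D"
  proof
    assume "Y + (- \<epsilon>) *\<^sub>R D = Y + \<epsilon> *\<^sub>R D"
    moreover have "(2 * \<epsilon>) *\<^sub>R D = (Y + \<epsilon> *\<^sub>R D) - (Y + (- \<epsilon>) *\<^sub>R D)"
      by (simp only: mult_2 scaleR_add_left scaleR_minus_left) simp
    ultimately have "(2 * \<epsilon>) *\<^sub>R D = 0" by (metis diff_self)
    then show False using \<open>D \<noteq> 0\<close> \<open>0 < \<epsilon>\<close> by simp
  qed
  ultimately have "Y \<in> open_segment (Y + (- \<epsilon>) *\<^sub>R D) (Y + \<epsilon> *\<^sub>R D)"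
    by (metis midpoint_in_open_segment)
  moreover have "Y + (- \<epsilon>) *\<^sub>R D \<in> relaxation" "Y + \<epsilon> *\<^sub>R D \<in> relaxation"
    using in_relaxation[of "- \<epsilon>"] in_relaxation[of \<epsilon>] \<open>0 < \<epsilon>\<close> by simp_all
  ultimately show False using ext unfolding extreme_point_of_def by blast
qed

section \<open>Cores as the integral points\<close>

lemma core_in_relaxation:
  assumes X: "tsasm n X" and n: "odd n"
  shows "core pos X \<in> relaxation"
proof -
  have n': "n = 2 * k + 1" using n k_def by auto
  have sym: "X i j = X j i" if "i \<in> {1..k}" "j \<in> {1..k}" for i j
    using tsasm_entry_symmetries(1)[OF X, of i j] that n' by simp
  have L: "L pos i j (core pos X) = sum (X i) {1..j}" if "1 \<le> i" "i \<le> k" "j \<le> k" for i j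
    unfolding L_eq_sum
  proof (rule sum.cong)
    fix j' assume "j' \<in> {1..j}"
    then have "1 \<le> j'" "j' \<le> k" using that by auto
    from entry_core[OF that(1,2) this sym] show "sym_entry (core pos X) i j' = X i j'" .
  qed simp
  have L01: "L pos i j (core pos X) \<in> {0, 1}" if "1 \<le> i" "i \<le> k" "j \<le> k" for i j
    using L[OF that] tsasm_row(1)[OF X, of i j] that n' by simp
  have last: "corner_sum (core pos X) i k = real (i div 2)" if "i \<le> k" for i
    using that
  proof (induction i)
    case 0
    then show ?case by (simp add: corner_sum_0)
  next
    case (Suc i)
    have "L pos (Suc i) k (core pos X) = (if even (Suc i) then 1 else 0)"
      using L[of "Suc i" k] tsasm_row_half_sum[OF X n', of "Suc i"] Suc.prems n' by simp
    then show ?case using Suc by (auto simp: corner_sum_Suc elim!: evenE oddE)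
  qed
  \<comment> \<open>Column 1 of the corner sums, equal to row 1 by symmetry, is non-negative and
    non-decreasing, and ends at \<open>1 div 2 = 0\<close>.\<close>
  have "corner_sum (core pos X) 1 j = 0" if j: "1 \<le> j" "j \<le> k" for j
  proof -
    have incr: "corner_sum (core pos X) i 1 \<le> corner_sum (core pos X) (Suc i) 1" if "Suc i \<le> k" for i
      using L01[of "Suc i" 1] that j by (auto simp: corner_sum_Suc)
    have "corner_sum (core pos X) j 1 \<le> corner_sum (core pos X) m 1" if "j \<le> m" "m \<le> k" for m
      using that
    proof (induction m rule: dec_induct)
      case (step m)
      then have "corner_sum (core pos X) m 1 \<le> corner_sum (core pos X) (Suc m) 1" using incr by blast
      with step show ?case by simp
    qed simp
    from this[of k] have "corner_sum (core pos X) 1 j \<le> 0"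
      using last[of 1] j corner_sum_commute[of "core pos X" 1 j] corner_sum_commute[of "core pos X" 1 k] by simp
    moreover have "0 \<le> corner_sum (core pos X) 1 j"
      using L01[of 1 j] L_eq_diff[of 1 j "core pos X"] j by (auto simp: corner_sum_0)
    ultimately show ?thesis by simp
  qed
  moreover have "L pos i j (core pos X) \<in> {0..1}" if "i \<in> {2..k}" "j \<in> {1..k}" for i j
    using L01[of i j] that by auto
  ultimately show ?thesis
    using last by (auto simp: relaxation_def boundary_space_def)
qed

text \<open>Integrality forces the partial row sums of the block to be 0 or 1. The middle row and
  column are filled with alternating signs and the remaining quadrants by reflection, after which
  each line is controlled by its left half.\<close>

lemma integral_point_is_core:
  assumes Y: "Y \<in> relaxation" and n: "odd n"
    and int: "\<And>i j. 1 \<le> i \<Longrightarrow> i \<le> k \<Longrightarrow> 1 \<le> j \<Longrightarrow> j \<le> k \<Longrightarrow> corner_sum Y i j \<in> \<int>"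
  shows "\<exists>X. tsasm n X \<and> core pos X = Y"
proof -
  have n': "n = 2 * k + 1" using n k_def by auto
  have ints: "corner_sum Y i j \<in> \<int>" if "i \<le> k" "j \<le> k" for i j
    using int[of i j] that by (cases "i = 0 \<or> j = 0") (auto simp: corner_sum_0)
  have L01: "L pos i j Y \<in> {0, 1}" if "1 \<le> i" "i \<le> k" "j \<le> k" for i j
  proof -
    have "L pos i j Y \<in> \<int>"
      using that ints[of i j] ints[of "i - 1" j] by (simp add: L_eq_diff)
    then obtain z :: int where z: "L pos i j Y = of_int z" by (auto elim: Ints_cases)
    then have "0 \<le> z" "z \<le> 1" using relaxation_L_bounds[OF Y that] by auto
    then show ?thesis using z by (cases "z = 0") auto
  qed
  have last: "L pos i k Y = (if even i then 1 else 0)" if "1 \<le> i" "i \<le> k" for i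
  proof -
    have bd: "corner_sum Y i k = real (i div 2)" if "1 \<le> i" "i \<le> k" for i
      using Y that unfolding relaxation_def boundary_space_def by simp
    then have "corner_sum Y i k = real (i div 2)" using that .
    moreover have "corner_sum Y (i - 1) k = real ((i - 1) div 2)"
    proof (cases "i = 1")
      case True
      then show ?thesis by (simp add: corner_sum_0)
    next
      case False
      then show ?thesis using bd[of "i - 1"] that by simp
    qed
    moreover have "i div 2 = (i - 1) div 2 + (if even i then 1 else 0)" using that by presburger
    ultimately show ?thesis using that by (auto simp: L_eq_diff)
  qed
  \<comment> \<open>These are the values forced by \<open>tsasm_middle_column\<close> and
    \<open>tsasm_row_half_sum\<close>.\<close>
  define mid where "mid i = (if odd i then 1 else -1 :: real)" for i :: nat
  define base where "base i j = (if i = k + 1 then mid j else if j = k + 1 then mid i else sym_entry Y i j)" for i j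
  define fold where "fold i = min i (n + 1 - i)" for i
  define X where "X i j = base (fold i) (fold j)" for i j
  have base_sym: "base i j = base j i" for i j
    by (auto simp: base_def sym_entry_commute)
  have fold: "fold i \<in> {1..k + 1}" if "i \<in> {1..n}" for i
    using that n' by (auto simp: fold_def)
  have fold_refl: "fold (n + 1 - i) = fold i" if "i \<in> {1..n}" for i
    using that by (auto simp: fold_def)
  have fold_id: "fold i = i" if "i \<le> k + 1" for i
    using that n' by (simp add: fold_def)
  have row: "alternating_line n (X i) \<and> (\<forall>j\<in>{1..n}. X i j \<in> {0, 1, -1})" if i: "i \<in> {1..n}" for i
  proof -
    have half: "sum (X i) {1..j} \<in> {0, 1}" if "j \<le> k" for j
    proof (cases "fold i = k + 1")
      case True
      have "sum (X i) {1..j} = (\<Sum>j=1..j. mid j)"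
        using that by (intro sum.cong) (auto simp: X_def base_def True fold_id)
      moreover have "(\<Sum>j=1..j. mid j) = (if odd j then 1 else 0)"
        by (induction j) (auto simp: mid_def)
      ultimately show ?thesis by simp
    next
      case False
      then have f: "1 \<le> fold i" "fold i \<le> k" using fold[OF i] by auto
      have "sum (X i) {1..j} = L pos (fold i) j Y"
        unfolding L_eq_sum using that False by (intro sum.cong) (auto simp: X_def base_def fold_id)
      then show ?thesis using L01[OF f that] by simp
    qed
    \<comment> \<open>With this middle entry, reflection makes the whole row sum to 1.\<close>
    have mid: "X i (k + 1) = 1 - 2 * sum (X i) {1..k}"
    proof (cases "fold i = k + 1")
      case True
      have "sum (X i) {1..k} = (\<Sum>j=1..k. mid j)"
        by (intro sum.cong) (auto simp: X_def base_def True fold_id)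
      moreover have "(\<Sum>j=1..m. mid j) = (if odd m then 1 else 0)" for m
        by (induction m) (auto simp: mid_def)
      ultimately show ?thesis by (simp add: X_def base_def True fold_id mid_def)
    next
      case False
      then have f: "1 \<le> fold i" "fold i \<le> k" using fold[OF i] by auto
      have "sum (X i) {1..k} = L pos (fold i) k Y"
        unfolding L_eq_sum using False by (intro sum.cong) (auto simp: X_def base_def fold_id)
      then show ?thesis using last[OF f] False by (simp add: X_def base_def fold_id mid_def)
    qed
    have "X i (2 * k + 2 - j) = X i j" if "j \<in> {1..2 * k + 1}" for j
      using fold_refl[of j] that n' by (simp add: X_def)
    from sum_symmetric_half[of k "X i", OF this]
    have upper: "sum (X i) {1..k + 1 + t} = 1 - sum (X i) {1..k - t}" if "t \<le> k" for t
      using mid that by simp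
    have sums: "sum (X i) {1..j} \<in> {0, 1}" if "j \<le> n" for j
    proof (cases "j \<le> k")
      case True
      then show ?thesis by (rule half)
    next
      case False
      then have "j = k + 1 + (j - k - 1)" "j - k - 1 \<le> k" using that n' by auto
      then have "sum (X i) {1..j} = 1 - sum (X i) {1..k - (j - k - 1)}" using upper by metis
      then show ?thesis using half[of "k - (j - k - 1)"] by auto
    qed
    moreover have "sum (X i) {1..n} = 1"
      using upper[of k] n' by (simp add: mult_2)
    moreover have entries: "\<forall>j\<in>{1..n}. X i j \<in> {0, 1, -1}"
    proof
      fix j assume j: "j \<in> {1..n}"
      then have "X i j = sum (X i) {1..j} - sum (X i) {1..j - 1}" using sum_pred[of j "X i"] by simp
      moreover have "j \<le> n" "j - 1 \<le> n" using j by auto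
      ultimately show "X i j \<in> {0, 1, -1}" using sums[of j] sums[of "j - 1"] by auto
    qed
    ultimately show ?thesis using alternating_line_iff_partial_sums by blast
  qed
  have Xsym: "X i j = X j i" for i j by (simp add: X_def base_sym)
  have "alternating_line n (\<lambda>i. X i j)" if "j \<in> {1..n}" for j
  proof -
    have "(\<lambda>i. X i j) = X j" using Xsym by blast
    then show ?thesis using row[OF that] by simp
  qed
  moreover have "X i j = X i (n + 1 - j)" if "j \<in> {1..n}" for i j
    using fold_refl[OF that] by (simp add: X_def)
  ultimately have "tsasm n X"
    unfolding tsasm_def asm_def using row Xsym by blast
  moreover have "core pos X = Y"
  proof (rule eqI_sym_entry)
    fix i j assume ij: "1 \<le> i" "i \<le> k" "1 \<le> j" "j \<le> k"
    have "sym_entry (core pos X) i j = X i j" by (rule entry_core[OF ij Xsym])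
    also have "X i j = sym_entry Y i j" using ij by (simp add: X_def base_def fold_id)
    finally show "sym_entry (core pos X) i j = sym_entry Y i j" .
  qed
  ultimately show ?thesis by blast
qed

text \<open>A compact convex set is the hull of its extreme points, and those of
  \<open>relaxation\<close> are integral, hence cores.\<close>

lemma polytope_eq_relaxation:
  assumes "odd n"
  shows "tsasm_core_polytope n pos = relaxation"
proof
  show "tsasm_core_polytope n pos \<subseteq> relaxation"
    unfolding tsasm_core_polytope_def
    using core_in_relaxation assms convex_relaxation by (intro hull_minimal) auto
  have "{Y. Y extreme_point_of relaxation} \<subseteq> core pos ` {X. tsasm n X}"
  proof
    fix Y assume "Y \<in> {Y. Y extreme_point_of relaxation}"
    then have ext: "Y extreme_point_of relaxation" by simp
    then have "Y \<in> relaxation" by (simp add: extreme_point_of_def)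
    from integral_point_is_core[OF this assms extreme_point_integral[OF ext]]
    show "Y \<in> core pos ` {X. tsasm n X}" by blast
  qed
  then show "relaxation \<subseteq> tsasm_core_polytope n pos"
    unfolding tsasm_core_polytope_def
    using Krein_Milman_Minkowski[OF compact_relaxation convex_relaxation] hull_mono by blast
qed

section \<open>Irredundancy and the facets\<close>

lemma of_corner_sums_in_boundary_space:
  assumes "\<And>p q. h p q = h q p" and "\<And>q. 1 \<le> q \<Longrightarrow> q \<le> k \<Longrightarrow> h 1 q = 0 \<and> h q k = real (q div 2)"
  shows "of_corner_sums h \<in> boundary_space"
  using assms corner_sum_of_corner_sums[of h, OF assms(1)] by (auto simp: boundary_space_def)

lemma L_of_corner_sums:
  assumes "\<And>p q. h p q = h q p" and "2 \<le> i" "i \<le> k" "1 \<le> j" "j \<le> k"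
  shows "L pos i j (of_corner_sums h) = h i j - h (i - 1) j"
proof -
  have "1 \<le> i" "1 \<le> i - 1" "i - 1 \<le> k" using assms by auto
  then show ?thesis
    using assms corner_sum_of_corner_sums[of h, OF assms(1)] by (simp add: L_eq_diff)
qed

lemma relaxation_eq_listed:
  assumes k: "4 \<le> k"
  shows "relaxation = {Y \<in> boundary_space. (\<forall>(i, j)\<in>zero_indices k. 0 \<le> L pos i j Y) \<and>
    (\<forall>(i, j)\<in>one_indices k. L pos i j Y \<le> 1)}"
proof (intro subset_antisym subsetI)
  fix Y assume Y: "Y \<in> relaxation"
  have "L pos i j Y \<in> {0..1}" if "(i, j) \<in> zero_indices k \<or> (i, j) \<in> one_indices k" for i j
    using that zero_indices_bounds[of i j k] one_indices_bounds[of i j k] k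
    by (intro relaxation_L_bounds[OF Y]) auto
  then show "Y \<in> {Y \<in> boundary_space. (\<forall>(i, j)\<in>zero_indices k. 0 \<le> L pos i j Y) \<and>
      (\<forall>(i, j)\<in>one_indices k. L pos i j Y \<le> 1)}"
    using Y unfolding relaxation_def by auto
next
  fix Y assume Y: "Y \<in> {Y \<in> boundary_space. (\<forall>(i, j)\<in>zero_indices k. 0 \<le> L pos i j Y) \<and>
      (\<forall>(i, j)\<in>one_indices k. L pos i j Y \<le> 1)}"
  have L: "L pos i j Y = corner_sum Y i j - corner_sum Y (i - 1) j" if "2 \<le> i" for i j
    using that by (intro L_eq_diff) simp
  have zero: "corner_sum Y (i - 1) j \<le> corner_sum Y i j" if "(i, j) \<in> zero_indices k" for i j
    using Y that L[of i j] zero_indices_bounds[OF that k] by auto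
  have one: "corner_sum Y i j \<le> corner_sum Y (i - 1) j + 1" if "(i, j) \<in> one_indices k" for i j
    using Y that L[of i j] one_indices_bounds[OF that k] by auto
  have first: "corner_sum Y 1 j = 0" and last: "corner_sum Y j k = real (j div 2)" if "1 \<le> j" "j \<le> k" for j
    using Y that unfolding boundary_space_def by auto
  have "corner_sum Y (i - 1) j \<le> corner_sum Y i j \<and> corner_sum Y i j \<le> corner_sum Y (i - 1) j + 1"
    if "2 \<le> i" "i \<le> k" "1 \<le> j" "j \<le> k" for i j
    by (rule all_bounds_of_listed_bounds[OF k corner_sum_commute]) (blast intro: first last zero one that)+
  note bounds = this
  have "L pos i j Y \<in> {0..1}" if "i \<in> {2..k}" "j \<in> {1..k}" for i j
    using bounds[of i j] L[of i j] that by auto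
  then show "Y \<in> relaxation" using Y by (auto simp: relaxation_def)
qed

text \<open>
  The bilinear array \<open>(i - 1) (j - 1) / (2 (k - 1))\<close> interpolates the boundary value \<open>i div 2\<close>
  at \<open>j = k\<close> up to an error of \<open>1 / 2\<close>, which the last step absorbs.
\<close>

lemma interior_point:
  assumes k: "4 \<le> k"
  obtains Z where "Z \<in> boundary_space"
    and "\<And>i j. 2 \<le> i \<Longrightarrow> i \<le> k \<Longrightarrow> 2 \<le> j \<Longrightarrow> j < k \<Longrightarrow> 0 < L pos i j Z \<and> L pos i j Z < 1"
proof
  define h where "h i j = (if i = k then real (j div 2) else if j = k then real (i div 2)
    else (real i - 1) * (real j - 1) / (2 * (real k - 1)))" for i j
  have sym: "h p q = h q p" for p q by (auto simp: h_def)
  show "of_corner_sums h \<in> boundary_space"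
    using k sym by (intro of_corner_sums_in_boundary_space) (auto simp: h_def)
  fix i j assume i: "2 \<le> i" "i \<le> k" and j: "2 \<le> j" "j < k"
  \<comment> \<open>The increment of the bilinear array along the first index. It is below
    \<open>1 / 2\<close> because \<open>j < k\<close>, which leaves room for the boundary
    error.\<close>
  define t where "t = (real j - 1) / (2 * (real k - 1))"
  have t: "0 < t" "t < 1 / 2" using j by (auto simp: t_def field_simps)
  have "h i j - h (i - 1) j \<in> {t, t + 1 / 2}"
  proof (cases "i = k")
    case True
    have "k - 1 \<noteq> k" using k by simp
    then have "h (i - 1) j = (real j - 1) / 2 - t"
      using True i j k by (simp add: h_def t_def field_simps of_nat_diff)
    moreover have "real (j div 2) = (real j - 1) / 2 \<or> real (j div 2) = (real j - 1) / 2 + 1 / 2"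
      by (cases "even j") (auto elim!: evenE oddE simp: field_simps)
    ultimately show ?thesis using True by (auto simp: h_def)
  next
    case False
    moreover have "i - 1 \<noteq> k" using i by auto
    ultimately have "h i j - h (i - 1) j = (real i - 1) * t - (real i - 2) * t"
      using i j k by (simp add: h_def t_def of_nat_diff)
    then show ?thesis by (simp add: algebra_simps)
  qed
  then show "0 < L pos i j (of_corner_sums h) \<and> L pos i j (of_corner_sums h) < 1"
    using L_of_corner_sums[of h i j, OF sym] i j t by auto
qed

lemma point_of_violating_array:
  assumes W: "violates_only (int k) (int i, int j) d W" and ij: "2 \<le> i" "i \<le> k" "1 \<le> j" "j \<le> k"
  obtains Y where "Y \<in> boundary_space" and "L pos i j Y = of_int d"
    and "\<And>p q. 2 \<le> p \<Longrightarrow> p \<le> k \<Longrightarrow> 1 \<le> q \<Longrightarrow> q \<le> k \<Longrightarrow> (p, q) \<noteq> (i, j) \<Longrightarrow> L pos p q Y \<in> {0, 1}"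
proof
  define h where "h p q = real_of_int (W (int p) (int q))" for p q
  have sym: "h p q = h q p" for p q
    using W by (simp add: h_def violates_only_def corner_array_def)
  have W_boundary: "W 1 q = 0 \<and> W q (int k) = q div 2" if "1 \<le> q" "q \<le> int k" for q
    using W that unfolding violates_only_def corner_array_def by blast
  have boundary: "h 1 q = 0 \<and> h q k = real (q div 2)" if "1 \<le> q" "q \<le> k" for q
  proof -
    have "W 1 (int q) = 0" "W (int q) (int k) = int (q div 2)"
      using W_boundary[of "int q"] that by (simp_all add: zdiv_int)
    then show ?thesis by (simp only: h_def of_nat_1 of_int_of_nat_eq of_int_0 simp_thms)
  qed
  show "of_corner_sums h \<in> boundary_space"
    by (rule of_corner_sums_in_boundary_space[OF sym]) (use boundary in blast)
  have L: "L pos p q (of_corner_sums h) = of_int (W (int p) (int q) - W (int p - 1) (int q))"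
    if "2 \<le> p" "p \<le> k" "1 \<le> q" "q \<le> k" for p q
    using L_of_corner_sums[of h p q, OF sym that] that by (simp add: h_def of_nat_diff)
  have W_step: "if (p, q) = (int i, int j) then W p q - W (p - 1) q = d else W p q - W (p - 1) q \<in> {0, 1}"
    if "2 \<le> p" "p \<le> int k" "1 \<le> q" "q \<le> int k" for p q
    using W that unfolding violates_only_def by blast
  have W': "if (int p, int q) = (int i, int j) then W (int p) (int q) - W (int p - 1) (int q) = d
       else W (int p) (int q) - W (int p - 1) (int q) \<in> {0, 1}"
    if "2 \<le> p" "p \<le> k" "1 \<le> q" "q \<le> k" for p q
    by (rule W_step) (use that in simp_all)
  show "L pos i j (of_corner_sums h) = of_int d"
    using L[OF ij] W'[OF ij] by simp
  show "L pos p q (of_corner_sums h) \<in> {0, 1}"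
    if "2 \<le> p" "p \<le> k" "1 \<le> q" "q \<le> k" "(p, q) \<noteq> (i, j)" for p q
    using L[OF that(1-4)] W'[OF that(1-4)] that(5) by (auto simp del: of_int_diff)
qed

text \<open>The expression \<open>3 * c - 1\<close> unites both kinds of violation: it is -1 for
  \<open>c = 0\<close> and 2 for \<open>c = 1\<close>.\<close>

lemma violating_point:
  assumes k: "4 \<le> k" and t: "((i, j), c) \<in> zero_indices k \<times> {0} \<union> one_indices k \<times> {1 :: real}"
  shows "\<exists>Y \<in> boundary_space. L pos i j Y = 3 * c - 1 \<and>
    (\<forall>p q. 2 \<le> p \<longrightarrow> p \<le> k \<longrightarrow> 1 \<le> q \<longrightarrow> q \<le> k \<longrightarrow> (p, q) \<noteq> (i, j) \<longrightarrow> L pos p q Y \<in> {0, 1})"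
proof -
  have ij: "2 \<le> i" "i \<le> k" "1 \<le> j" "j \<le> k"
    using t zero_indices_bounds[of i j k] one_indices_bounds[of i j k] k by auto
  have k': "4 \<le> int k" using k by simp
  have "\<exists>d W. violates_only (int k) (int i, int j) d W \<and> of_int d = 3 * c - 1"
  proof (cases "c = 0")
    case True
    then have "(i, j) \<in> zero_indices k" using t by auto
    from zero_indices_cases[OF this k] have "\<exists>W. violates_only (int k) (int i, int j) (-1) W"
      using violates_only_zero[OF k', of "int i" "int j"] violates_only_22[OF k'] by auto
    then show ?thesis using True by force
  next
    case False
    then have "(i, j) \<in> one_indices k" "c = 1" using t by auto
    then show ?thesis
      using violates_only_one[OF k' one_indices_cases[OF _ k]] by force
  qed
  then obtain d W where "violates_only (int k) (int i, int j) d W" "of_int d = 3 * c - 1" by blast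
  then show ?thesis
    using point_of_violating_array[OF _ ij] by metis
qed

lemma facets_relaxation:
  assumes k: "4 \<le> k"
  shows "bij_betw (\<lambda>((i, j), c). {Y \<in> relaxation. L pos i j Y = c})
    (zero_indices k \<times> {0} \<union> one_indices k \<times> {1}) {F. F facet_of relaxation}"
proof -
  define T where "T = zero_indices k \<times> {0} \<union> one_indices k \<times> {1 :: real}"
  \<comment> \<open>The sign change turns the constraints with \<open>c = 0\<close> into upper
    bounds, so in both cases the right-hand side is \<open>c\<close> itself.\<close>
  define f where "f t Y = (case t of ((i, j), c) \<Rightarrow> if c = 0 then - L pos i j Y else L pos i j Y)" for t :: "(nat \<times> nat) \<times> real" and Y
  obtain Z where Z: "Z \<in> boundary_space"
    "\<And>i j. 2 \<le> i \<Longrightarrow> i \<le> k \<Longrightarrow> 2 \<le> j \<Longrightarrow> j < k \<Longrightarrow> 0 < L pos i j Z \<and> L pos i j Z < 1"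
    using interior_point[OF k] by blast
  have T_bounds: "2 \<le> i" "i \<le> k" "2 \<le> j" "j < k" "c = 0 \<or> c = 1" if "((i, j), c) \<in> T" for i j c
    using that zero_indices_bounds[of i j k] one_indices_bounds[of i j k] k by (auto simp: T_def)
  have "\<forall>t\<in>T. \<exists>Y. Y \<in> boundary_space \<and> L pos (fst (fst t)) (snd (fst t)) Y = 3 * snd t - 1 \<and>
      (\<forall>p q. 2 \<le> p \<longrightarrow> p \<le> k \<longrightarrow> 1 \<le> q \<longrightarrow> q \<le> k \<longrightarrow> (p, q) \<noteq> fst t \<longrightarrow> L pos p q Y \<in> {0, 1})"
    using violating_point[OF k] unfolding T_def by (metis prod.collapse)
  then obtain w where w: "\<And>t. t \<in> T \<Longrightarrow> w t \<in> boundary_space"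
    "\<And>i j c. ((i, j), c) \<in> T \<Longrightarrow> L pos i j (w ((i, j), c)) = 3 * c - 1"
    "\<And>t p q. t \<in> T \<Longrightarrow> 2 \<le> p \<Longrightarrow> p \<le> k \<Longrightarrow> 1 \<le> q \<Longrightarrow> q \<le> k \<Longrightarrow> (p, q) \<noteq> fst t \<Longrightarrow> L pos p q (w t) \<in> {0, 1}"
    by (metis fst_conv snd_conv)
  have "bij_betw (\<lambda>t. {Y \<in> relaxation. f t Y = snd t}) T {F. F facet_of relaxation}"
  proof (rule facets_of_irredundant_system[where A = boundary_space and z = Z and w = w])
    show "finite T" by (simp add: T_def finite_indices)
    show "linear (f t)" if "t \<in> T" for t
    proof -
      obtain i j c where "t = ((i, j), c)" by (metis prod.collapse)
      then have "f t = (if c = 0 then \<lambda>Y. - L pos i j Y else L pos i j)"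
        by (auto simp: f_def[abs_def])
      then show ?thesis using linear_L linear_compose_neg[OF linear_L[of i j]] by simp
    qed
    show "relaxation = {Y \<in> boundary_space. \<forall>t\<in>T. f t Y \<le> snd t}"
    proof -
      have "(\<forall>t\<in>zero_indices k \<times> {0}. f t Y \<le> snd t) \<longleftrightarrow> (\<forall>(i, j)\<in>zero_indices k. 0 \<le> L pos i j Y)"
        "(\<forall>t\<in>one_indices k \<times> {1}. f t Y \<le> snd t) \<longleftrightarrow> (\<forall>(i, j)\<in>one_indices k. L pos i j Y \<le> 1)" for Y
        by (auto simp: f_def)
      then show ?thesis unfolding relaxation_eq_listed[OF k] T_def ball_Un by simp
    qed
    show "f t Z < snd t" if "t \<in> T" for t
    proof -
      obtain i j c where t: "t = ((i, j), c)" by (metis prod.collapse)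
      then show ?thesis using Z(2)[of i j] T_bounds[of i j c] that by (auto simp: f_def)
    qed
    show "snd t < f t (w t)" if "t \<in> T" for t
    proof -
      obtain i j c where t: "t = ((i, j), c)" by (metis prod.collapse)
      then show ?thesis using w(2)[of i j c] T_bounds(5)[of i j c] that by (auto simp: f_def)
    qed
    show "f s (w t) \<le> snd s" if "s \<in> T" "t \<in> T" "s \<noteq> t" for s t
    proof -
      obtain i j c where t: "t = ((i, j), c)" by (metis prod.collapse)
      obtain p q e where s: "s = ((p, q), e)" by (metis prod.collapse)
      have e: "e = 0 \<or> e = 1" "c = 0 \<or> c = 1" using T_bounds(5) that s t by blast+
      show ?thesis
      proof (cases "(p, q) = (i, j)")
        case True
        \<comment> \<open>Same cell, opposite bound: the value -1 respects the upper bound 1, and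
          the value 2 respects the lower bound 0.\<close>
        then show ?thesis using w(2)[of i j c] e that by (auto simp: f_def s t)
      next
        case False
        then have "L pos p q (w t) \<in> {0, 1}"
          using T_bounds[of p q e] that s t by (intro w(3)) auto
        then show ?thesis using e by (auto simp: f_def s)
      qed
    qed
  qed (use affine_boundary_space Z w in auto)
  moreover have "{Y \<in> relaxation. f t Y = snd t} = (case t of ((i, j), c) \<Rightarrow> {Y \<in> relaxation. L pos i j Y = c})"
    if "t \<in> T" for t
    using that by (auto simp: f_def T_def)
  ultimately show ?thesis
    unfolding T_def[symmetric] by (subst (asm) bij_betw_cong) (auto simp: case_prod_beta)
qed

end

theorem theorem9p7:
  fixes n k :: nat and pos :: "'c::finite \<Rightarrow> nat \<times> nat" and P :: "(real ^ 'c) set"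
  assumes "n \<ge> 9" and "odd n"
    and "k = n div 2"
    and "bij_betw pos UNIV (core_positions n)"
    and "P = tsasm_core_polytope n pos"
  shows "bij_betw (\<lambda>((i, j), c). {Y \<in> P. L pos i j Y = c})
           (zero_indices k \<times> {0} \<union> one_indices k \<times> {1})
           {F. F facet_of P}
       \<and> real (card {F. F facet_of P}) = ((real n)\<^sup>2 - 15 * real n + 62) / 2"
proof -
  interpret core_space n k pos by unfold_locales (use assms in auto)
  have k: "4 \<le> k" and n: "n = 2 * k + 1" using assms(1-3) by auto
  have P: "P = relaxation" using assms polytope_eq_relaxation by simp
  have bij: "bij_betw (\<lambda>((i, j), c). {Y \<in> P. L pos i j Y = c})
      (zero_indices k \<times> {0} \<union> one_indices k \<times> {1}) {F. F facet_of P}"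
    unfolding P by (rule facets_relaxation[OF k])
  have "card {F. F facet_of P} = card (zero_indices k \<times> {0 :: real} \<union> one_indices k \<times> {1})"
    using bij_betw_same_card[OF bij] by simp
  \<comment> \<open>The tags 0 and 1 make the union disjoint although the two index sets may
    overlap.\<close>
  also have "\<dots> = card (zero_indices k) + card (one_indices k)"
    using finite_indices by (subst card_Un_disjoint) (auto simp: card_cartesian_product)
  also have "\<dots> = 2 + (k - 3) * (k - 2) + (k - 4) * (k - 4)"
    by (rule card_indices[OF k])
  finally have "real (card {F. F facet_of P}) = 2 + (real k - 3) * (real k - 2) + (real k - 4) * (real k - 4)"
    using k by (simp add: of_nat_diff)
  also have "\<dots> = ((real n)\<^sup>2 - 15 * real n + 62) / 2"
    by (simp add: n power2_eq_square field_simps)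
  finally show ?thesis using bij by blast
qed

end
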